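(* If $\dim E=n-1\equiv0\pmod 8$, every non-zero charge spin representation $\rho$ of the Heisenberg algebra $\mathfrak{heis}_b=E^*+E+\mathbb R\mathrm p$ is given (for one choice of the sign $\pm$, the same throughout) by $$\rho(\mathrm p)=\sqrt2\begin{pmatrix}0&h_1(\mathrm{Id}\pm\mathcal E)\\0&0\end{pmatrix},$$ $$\rho(e)=\frac12\begin{pmatrix}h_3(e)\mathrm{Id}-h_1e\pm h_1e\,\mathcal E&2\rho_{12}(e)\\0&h_3(e)\mathrm{Id}+h_1e\pm h_1e\,\mathcal E\end{pmatrix}\qquad(e\in E),$$ where $h_1\in\mathbb R$ satisfies $h_1\ne0$, $h_3\in\mathrm{Hom}_{\mathbb R}(E,\mathbb R)$, and $\rho_{12}\in\mathrm{Hom}_{\mathbb R}(E,\mathrm{End}_{\mathbb R}(S_{0,n-1}))$ is $(\rho_{11},\rho_{22})$-suitable, $\rho_{11},\rho_{22}$ being the diagonal blocks of $\rho$ on $E$.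
   Context: $E=\mathbb R^{0,n-1}$ is an $(n-1)$-dimensional real vector space with a negative definite inner product $\langle\cdot,\cdot\rangle$; $e^\flat=\langle e,\cdot\rangle\in E^*$. $b$ is a non-degenerate symmetric bilinear form on $E$ and $B\in\mathrm{End}_{\mathbb R}(E)$ is defined by $b(\cdot,\cdot)=-\langle B\cdot,\cdot\rangle$. The Heisenberg algebra $\mathfrak{heis}_b=E^*+E+\mathbb R\mathrm p$ has as only non-trivial brackets $[e^\flat,f]=b(e,f)\mathrm p$ ($e,f\in E$). $\mathrm{Cl}_{0,n-1}$ is the Clifford algebra of $E$ with convention $v^2=-\langle v,v\rangle$ (so unit vectors of $E$ square to $+1$), $S_{0,n-1}$ is a real irreducible $\mathrm{Cl}_{0,n-1}$-module, on which a vector $e\in E$ acts by Clifford multiplication (denoted again $e$). For $n-1\equiv 0\pmod 8$, $\mathcal E\in\mathrm{End}_{\mathbb R}(S_{0,n-1})$ is the para-complex structure given by the action of the volume form $\omega_{0,n-1}=e_1\cdots e_{n-1}$ ($e_i$ an orthonormal basis of $E$); $\mathcal E^2=\mathrm{Id}$ and $\mathcal E$ anticommutes with Clifford multiplication by vectors. (The paper denotes it $E$.) The algebra of endomorphisms of $S_{0,n-1}$ commuting with $\mathrm{Cl}_{0,n-1}$ is $\mathbb R\,\mathrm{Id}$. Let $\mathfrak m=E+\mathbb R\mathrm p+\mathbb R\mathrm q$ be Minkowski space ($\mathrm p,\mathrm q$ isotropic, orthogonal to $E$, $\langle\mathrm p,\mathrm q\rangle=1$) and $S=S_{1,n}$ the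 real irreducible $\mathrm{Cl}(\mathfrak m)$-module. It is identified, as a vector space, with $S=S_-+S_+=S_{0,n-1}+S_{0,n-1}$ (endomorphisms written as $2\times2$ block matrices) in such a way that $\mathrm p\wedge e\in\mathfrak{so}(\mathfrak m)$ acts as $\begin{pmatrix}0&\sqrt2\,e\\0&0\end{pmatrix}$. A Lie algebra representation $\rho:\mathfrak{heis}_b\to\mathfrak{gl}_{\mathbb R}(S)$ is called spin if $\rho(e^\flat)=\begin{pmatrix}0&\sqrt2\,Be\\0&0\end{pmatrix}$ for all $e\in E$ (the spin action of $\mathrm p\wedge Be$). It has non-zero charge if $\rho(\mathrm p)\neq0$. For fixed $\rho_{11},\rho_{22}\in\mathrm{Hom}_{\mathbb R}(E,\mathrm{End}_{\mathbb R}(S_{0,n-1}))$, a map $\rho_{12}\in\mathrm{Hom}_{\mathbb R}(E,\mathrm{End}_{\mathbb R}(S_{0,n-1}))$ is $(\rho_{11},\rho_{22})$-suitable if the bilinear map $e\otimes f\mapsto\rho_{11}(e)\circ\rho_{12}(f)-\rho_{12}(f)\circ\rho_{22}(e)$ on $E\otimes E$ is symmetric. *)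

theory Defs
  imports "HOL-Analysis.Analysis"
begin

text \<open>
  A Euclidean space of type \<open>'e\<close> with the negative of its inner product is the negative definite
  space E. Its dual is the type \<open>'e \<Rightarrow>\<^sub>L real\<close>, and \<open>End(S)\<close> is \<open>'s \<Rightarrow>\<^sub>L 's\<close>; all spaces are
  finite-dimensional, so boundedness of linear maps is no restriction and the norms play no role.
\<close>

definition ip :: "'e::euclidean_space \<Rightarrow> 'e \<Rightarrow> real"
  where "ip x y = - (x \<bullet> y)"

definition orthonormal_basis :: "'e::euclidean_space list \<Rightarrow> bool"
  where "orthonormal_basis es \<longleftrightarrow>
    length es = DIM('e) \<and>
    (\<forall>i<length es. \<forall>j<length es. ip (es ! i) (es ! j) = (if i = j then -1 else 0))"

lift_definition flat :: "'e::euclidean_space \<Rightarrow> 'e \<Rightarrow>\<^sub>L real" is "\<lambda>e x. ip e x"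
  unfolding ip_def by (intro bounded_linear_minus bounded_linear_inner_right)

definition sharp :: "('e::euclidean_space \<Rightarrow>\<^sub>L real) \<Rightarrow> 'e"
  where "sharp = inv flat"

lemma bij_flat: "bij (flat :: 'e::euclidean_space \<Rightarrow> _)"
proof (rule bijI)
  show "inj (flat :: 'e \<Rightarrow> _)"
  proof (rule injI)
    fix x y :: 'e assume "flat x = flat y"
    then have "\<forall>z. x \<bullet> z = y \<bullet> z"
      by (metis flat.rep_eq ip_def neg_equal_iff_equal)
    then show "x = y" by (metis vector_eq_ldot inner_commute)
  qed
  show "surj (flat :: 'e \<Rightarrow> _)"
  proof (rule surjI)
    fix a :: "'e \<Rightarrow>\<^sub>L real"
    let ?x = "- (\<Sum>i\<in>Basis. blinfun_apply a i *\<^sub>R i)"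
    show "flat ?x = a"
      by (rule blinfun_euclidean_eqI)
        (simp add: flat.rep_eq ip_def inner_sum_left inner_Basis if_distrib sum.delta cong: if_cong)
  qed
qed

lemma sharp_flat [simp]: "sharp (flat e) = e"
  unfolding sharp_def using bij_flat by (metis bij_is_inj inv_f_f)

lemma flat_sharp [simp]: "flat (sharp a) = a"
  unfolding sharp_def using bij_flat by (metis bij_is_surj surj_f_inv_f)

definition symmetric_form :: "('e \<Rightarrow> 'e \<Rightarrow> real) \<Rightarrow> bool"
  where "symmetric_form b \<longleftrightarrow> (\<forall>x y. b x y = b y x)"

definition nondegenerate_form :: "('e::euclidean_space \<Rightarrow> 'e \<Rightarrow> real) \<Rightarrow> bool"
  where "nondegenerate_form b \<longleftrightarrow> (\<forall>x. (\<forall>y. b x y = 0) \<longrightarrow> x = 0)"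


section \<open>The Heisenberg algebra\<close>

type_synonym 'e heis = "('e \<Rightarrow>\<^sub>L real) \<times> 'e \<times> real"

definition heis_dual :: "('e::euclidean_space \<Rightarrow>\<^sub>L real) \<Rightarrow> 'e heis"
  where "heis_dual \<alpha> = (\<alpha>, 0, 0)"

definition heis_vec :: "'e::euclidean_space \<Rightarrow> 'e heis"
  where "heis_vec e = (0, e, 0)"

definition heis_p :: "'e::euclidean_space heis"
  where "heis_p = (0, 0, 1)"

text \<open>
  The bilinear alternating extension of the brackets of generators; see
  \<open>heis_bracket_dual_vec\<close> and the lemmas following it.
\<close>

definition heis_bracket :: "('e::euclidean_space \<Rightarrow> 'e \<Rightarrow> real) \<Rightarrow> 'e heis \<Rightarrow> 'e heis \<Rightarrow> 'e heis"
  where "heis_bracket b X Y =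
    (case X of (\<alpha>, e, s) \<Rightarrow> case Y of (\<beta>, f, t) \<Rightarrow>
      (0, 0, b (sharp \<alpha>) f - b (sharp \<beta>) e))"

lemma heis_bracket_dual_vec:
  assumes "bilinear b"
  shows "heis_bracket b (heis_dual (flat e)) (heis_vec f) = b e f *\<^sub>R heis_p"
  by (simp add: heis_bracket_def heis_dual_def heis_vec_def heis_p_def bilinear_rzero[OF assms])

lemma
  assumes "bilinear b"
  shows heis_bracket_vec_vec: "heis_bracket b (heis_vec e) (heis_vec f) = 0"
    and heis_bracket_dual_dual: "heis_bracket b (heis_dual \<alpha>) (heis_dual \<beta>) = 0"
    and heis_bracket_p: "heis_bracket b heis_p X = 0"
proof -
  have "flat 0 = (0 :: 'a \<Rightarrow>\<^sub>L real)"
    by (rule blinfun_eqI) (simp add: flat.rep_eq ip_def)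
  then have "sharp 0 = (0 :: 'a)" by (metis sharp_flat)
  then show "heis_bracket b (heis_vec e) (heis_vec f) = 0"
    and "heis_bracket b (heis_dual \<alpha>) (heis_dual \<beta>) = 0"
    and "heis_bracket b heis_p X = 0"
    by (auto simp: heis_bracket_def heis_dual_def heis_vec_def heis_p_def zero_prod_def
        bilinear_rzero[OF assms] bilinear_lzero[OF assms] split: prod.splits)
qed

lemma heis_bracket_alternating: "heis_bracket b X X = 0"
  by (simp add: heis_bracket_def zero_prod_def split: prod.splits)

definition heis_representation ::
    "('e::euclidean_space \<Rightarrow> 'e \<Rightarrow> real) \<Rightarrow> ('e heis \<Rightarrow> 'v::euclidean_space \<Rightarrow>\<^sub>L 'v) \<Rightarrow> bool"
  where "heis_representation b \<rho> \<longleftrightarrow>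
    linear \<rho> \<and>
    (\<forall>X Y. \<rho> (heis_bracket b X Y) = (\<rho> X o\<^sub>L \<rho> Y) - (\<rho> Y o\<^sub>L \<rho> X))"


section \<open>Clifford modules\<close>

text \<open>
  By the universal property of the Clifford algebra, a module over it is a linear map
  \<open>c\<close> from E to \<open>End(S)\<close> with \<open>c(v)\<^sup>2 = -\<langle>v,v\<rangle> Id\<close>. Submodules are the subspaces invariant under
  \<open>c(v)\<close> for all \<open>v\<close>, as E generates the algebra. The module is nonzero because Euclidean space
  types have positive dimension.
\<close>

definition clifford_module :: "('e::euclidean_space \<Rightarrow> 's::euclidean_space \<Rightarrow>\<^sub>L 's) \<Rightarrow> bool"
  where "clifford_module c \<longleftrightarrow>
    linear c \<and> (\<forall>v. c v o\<^sub>L c v = (- ip v v) *\<^sub>R id_blinfun)"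

definition irreducible_clifford_module ::
    "('e::euclidean_space \<Rightarrow> 's::euclidean_space \<Rightarrow>\<^sub>L 's) \<Rightarrow> bool"
  where "irreducible_clifford_module c \<longleftrightarrow>
    clifford_module c \<and>
    (\<forall>W. subspace W \<and> (\<forall>v. \<forall>x\<in>W. blinfun_apply (c v) x \<in> W) \<longrightarrow> W = {0} \<or> W = UNIV)"

text \<open>The action of \<open>e\<^sub>1 \<cdots> e\<^sub>m\<close> for \<open>es = [e\<^sub>1, \<dots>, e\<^sub>m]\<close>.\<close>

definition volume_action ::
    "('e::euclidean_space \<Rightarrow> 's::euclidean_space \<Rightarrow>\<^sub>L 's) \<Rightarrow> 'e list \<Rightarrow> 's \<Rightarrow>\<^sub>L 's"
  where "volume_action c es = foldr (\<lambda>e T. c e o\<^sub>L T) es id_blinfun"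


section \<open>Block endomorphisms\<close>

definition inl_blinfun :: "'a::real_normed_vector \<Rightarrow>\<^sub>L ('a \<times> 'b::real_normed_vector)"
  where "inl_blinfun = Blinfun (\<lambda>x. (x, 0))"

definition inr_blinfun :: "'b::real_normed_vector \<Rightarrow>\<^sub>L ('a::real_normed_vector \<times> 'b)"
  where "inr_blinfun = Blinfun (\<lambda>y. (0, y))"

lemma blinfun_apply_inl [simp]: "blinfun_apply inl_blinfun x = (x, 0)"
  unfolding inl_blinfun_def
  by (subst bounded_linear_Blinfun_apply)
    (intro bounded_linear_Pair bounded_linear_ident bounded_linear_zero refl)+

lemma blinfun_apply_inr [simp]: "blinfun_apply inr_blinfun y = (0, y)"
  unfolding inr_blinfun_def
  by (subst bounded_linear_Blinfun_apply)
    (intro bounded_linear_Pair bounded_linear_ident bounded_linear_zero refl)+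

definition block :: "('s::euclidean_space \<Rightarrow>\<^sub>L 's) \<Rightarrow> ('s \<Rightarrow>\<^sub>L 's) \<Rightarrow> ('s \<Rightarrow>\<^sub>L 's) \<Rightarrow> ('s \<Rightarrow>\<^sub>L 's)
    \<Rightarrow> ('s \<times> 's) \<Rightarrow>\<^sub>L ('s \<times> 's)"
  where "block A B C D =
    (inl_blinfun o\<^sub>L A o\<^sub>L fst_blinfun) + (inl_blinfun o\<^sub>L B o\<^sub>L snd_blinfun) +
    (inr_blinfun o\<^sub>L C o\<^sub>L fst_blinfun) + (inr_blinfun o\<^sub>L D o\<^sub>L snd_blinfun)"

definition block11 :: "('s::euclidean_space \<times> 's) \<Rightarrow>\<^sub>L ('s \<times> 's) \<Rightarrow> 's \<Rightarrow>\<^sub>L 's"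
  where "block11 T = fst_blinfun o\<^sub>L T o\<^sub>L inl_blinfun"

definition block22 :: "('s::euclidean_space \<times> 's) \<Rightarrow>\<^sub>L ('s \<times> 's) \<Rightarrow> 's \<Rightarrow>\<^sub>L 's"
  where "block22 T = snd_blinfun o\<^sub>L T o\<^sub>L inr_blinfun"

lemma block_apply:
  "blinfun_apply (block A B C D) (x, y) =
    (blinfun_apply A x + blinfun_apply B y, blinfun_apply C x + blinfun_apply D y)"
  by (simp add: block_def blinfun.add_left)

lemma block11_block [simp]: "block11 (block A B C D) = A"
  by (rule blinfun_eqI) (simp add: block11_def block_apply)

lemma block22_block [simp]: "block22 (block A B C D) = D"
  by (rule blinfun_eqI) (simp add: block22_def block_apply)


section \<open>Spin representations\<close>

text \<open>
  The module \<open>S\<^sub>-+S\<^sub>+\<close> is \<open>'s \<times> 's\<close>. The matrix below is the action of \<open>p \<and> Be\<close> in this splitting.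
\<close>

definition spin_representation ::
    "('e::euclidean_space \<Rightarrow> 'e \<Rightarrow> real) \<Rightarrow> ('e \<Rightarrow> 'e) \<Rightarrow> ('e \<Rightarrow> 's::euclidean_space \<Rightarrow>\<^sub>L 's)
      \<Rightarrow> ('e heis \<Rightarrow> ('s \<times> 's) \<Rightarrow>\<^sub>L ('s \<times> 's)) \<Rightarrow> bool"
  where "spin_representation b B c \<rho> \<longleftrightarrow>
    heis_representation b \<rho> \<and>
    (\<forall>e. \<rho> (heis_dual (flat e)) = block 0 (sqrt 2 *\<^sub>R c (B e)) 0 0)"

definition suitable ::
    "('e \<Rightarrow> 's::euclidean_space \<Rightarrow>\<^sub>L 's) \<Rightarrow> ('e \<Rightarrow> 's \<Rightarrow>\<^sub>L 's)
      \<Rightarrow> ('e::euclidean_space \<Rightarrow> 's \<Rightarrow>\<^sub>L 's) \<Rightarrow> bool"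
  where "suitable \<rho>\<^sub>1\<^sub>1 \<rho>\<^sub>2\<^sub>2 \<rho>\<^sub>1\<^sub>2 \<longleftrightarrow>
    linear \<rho>\<^sub>1\<^sub>2 \<and>
    (\<forall>e f.
      (\<rho>\<^sub>1\<^sub>1 e o\<^sub>L \<rho>\<^sub>1\<^sub>2 f) - (\<rho>\<^sub>1\<^sub>2 f o\<^sub>L \<rho>\<^sub>2\<^sub>2 e) =
      (\<rho>\<^sub>1\<^sub>1 f o\<^sub>L \<rho>\<^sub>1\<^sub>2 e) - (\<rho>\<^sub>1\<^sub>2 e o\<^sub>L \<rho>\<^sub>2\<^sub>2 f))"

end

theory Submission
  imports Defs
begin

text \<open>
  Write \<open>A, D\<close> for the diagonal blocks of \<open>\<rho>\<close> on E and \<open>\<rho>(p) = sqrt 2 * H\<close> in the upper right block.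
  Since \<open>B\<close> is invertible, the bracket of \<open>E\<^sup>*\<close> with E says that the lower left block vanishes
  and that \<open>v D(f) - A(f) v = (v \<bullet> f) H\<close> for all vectors \<open>v, f\<close>, where \<open>v\<close> also denotes Clifford
  multiplication. The bracket of p with E says \<open>A(f) H = H D(f)\<close>, and the bracket of E with itself
  contains the suitability of the upper right block.

  Fix a unit vector \<open>f\<close>. For \<open>v\<close> orthogonal to \<open>f\<close>, \<open>v\<close> exchanges \<open>D(f)\<close> and \<open>A(f)\<close>. So their
  sum commutes with the orthogonal complement of \<open>f\<close> and their difference anticommutes with it.
  The volume element \<open>\<omega>\<close> anticommutes with all vectors in even dimension, so that by averaging over
  conjugation by \<open>f\<close> the commutant of the orthogonal complement of \<open>f\<close> is spanned by \<open>1\<close> and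
  \<open>f \<omega>\<close>, as soon as the commutant of the full Clifford algebra consists of scalars. Hence
  \<open>D(f) = \<alpha> + \<gamma> \<omega> + \<beta> f + \<delta> f \<omega>\<close>, \<open>A(f) = \<alpha> - \<gamma> \<omega> - \<beta> f + \<delta> f \<omega>\<close> and
  \<open>H = 2 \<beta> + 2 \<delta> \<omega>\<close> (\<open>intertwining_coefficients\<close>). The last equation shows that \<open>\<beta>\<close> and \<open>\<delta>\<close> do
  not depend on \<open>f\<close>, and comparing coefficients in \<open>A(f) H = H D(f)\<close> gives \<open>\<gamma> = 0\<close> and
  \<open>\<beta>\<^sup>2 = \<delta>\<^sup>2\<close> when \<open>H\<close> is nonzero (\<open>charge_condition\<close>). This is the asserted normal form.

  That the commutant is scalar depends on divisibility of the dimension by 8, which makes \<open>\<omega>\<close> an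
  involution as well. The Clifford algebra is then a full real matrix algebra: it is generated by
  mutually commuting pairs of anticommuting involutions, each pair generating a copy of the real
  2 by 2 matrices
  (\<open>matrix_pairs_of_involutions\<close>). The first members of all pairs have, in an irreducible module,
  exactly a line of common fixed vectors; an endomorphism of the module preserves this line and is
  therefore a scalar (\<open>matrix_pairs_commutant\<close>).
\<close>

section \<open>Commuting pairs of anticommuting involutions\<close>

definition commutes :: "('s::euclidean_space \<Rightarrow>\<^sub>L 's) \<Rightarrow> ('s \<Rightarrow>\<^sub>L 's) \<Rightarrow> bool"
  where "commutes a b \<longleftrightarrow> (\<forall>x. a (b x) = b (a x))"

definition anticommutes :: "('s::euclidean_space \<Rightarrow>\<^sub>L 's) \<Rightarrow> ('s \<Rightarrow>\<^sub>L 's) \<Rightarrow> bool"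
  where "anticommutes a b \<longleftrightarrow> (\<forall>x. a (b x) = - b (a x))"

definition involutive :: "('s::euclidean_space \<Rightarrow>\<^sub>L 's) \<Rightarrow> bool"
  where "involutive a \<longleftrightarrow> (\<forall>x. a (a x) = x)"

definition preserves :: "('s::euclidean_space \<Rightarrow>\<^sub>L 's) \<Rightarrow> 's set \<Rightarrow> bool"
  where "preserves a W \<longleftrightarrow> (\<forall>x\<in>W. a x \<in> W)"

type_synonym 's op_pair = "('s \<Rightarrow>\<^sub>L 's) \<times> ('s \<Rightarrow>\<^sub>L 's)"

definition matrix_pair :: "'s::euclidean_space op_pair \<Rightarrow> bool"
  where "matrix_pair = (\<lambda>(a, b). involutive a \<and> involutive b \<and> anticommutes a b)"

definition pairs_commute :: "'s::euclidean_space op_pair \<Rightarrow> 's op_pair \<Rightarrow> bool"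
  where "pairs_commute = (\<lambda>(a, b) (p, q).
    commutes a p \<and> commutes a q \<and> commutes b p \<and> commutes b q)"

definition matrix_pairs :: "'s::euclidean_space op_pair list \<Rightarrow> bool"
  where "matrix_pairs ps \<longleftrightarrow> (\<forall>p\<in>set ps. matrix_pair p) \<and> sorted_wrt pairs_commute ps"

lemma matrix_pairs_Cons:
  "matrix_pairs ((a, b) # ps) \<longleftrightarrow> matrix_pair (a, b) \<and>
    (\<forall>p\<in>set ps. pairs_commute (a, b) p) \<and> matrix_pairs ps"
  by (auto simp: matrix_pairs_def)

text \<open>
  The module generated by a common fixed vector \<open>x\<close> of the first members: products of second members
  applied to \<open>x\<close> span it, and each pair at most doubles the dimension.
\<close>
fun tower :: "'s::euclidean_space op_pair list \<Rightarrow> 's \<Rightarrow> 's set"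
  where "tower [] x = span {x}"
  | "tower ((a, b) # ps) x = {u + b w | u w. u \<in> tower ps x \<and> w \<in> tower ps x}"

lemma subspace_tower: "subspace (tower ps x)"
proof (induction ps)
  case (Cons p ps)
  obtain a b where p: "p = (a, b)" by fastforce
  show ?case unfolding p tower.simps
  proof (rule subspaceI)
    show "0 \<in> {u + b w | u w. u \<in> tower ps x \<and> w \<in> tower ps x}"
      using subspace_0[OF Cons.IH] by (force simp: blinfun.zero_right)
  next
    fix y z
    assume "y \<in> {u + b w | u w. u \<in> tower ps x \<and> w \<in> tower ps x}"
      and "z \<in> {u + b w | u w. u \<in> tower ps x \<and> w \<in> tower ps x}"
    then obtain u w u' w' where "u \<in> tower ps x" "w \<in> tower ps x" "u' \<in> tower ps x" "w' \<in> tower ps x"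
      "y = u + b w" "z = u' + b w'" by blast
    then have "y + z = (u + u') + b (w + w')" "u + u' \<in> tower ps x" "w + w' \<in> tower ps x"
      by (simp_all add: blinfun.add_right subspace_add[OF Cons.IH])
    then show "y + z \<in> {u + b w | u w. u \<in> tower ps x \<and> w \<in> tower ps x}" by blast
  next
    fix r y
    assume "y \<in> {u + b w | u w. u \<in> tower ps x \<and> w \<in> tower ps x}"
    then obtain u w where "u \<in> tower ps x" "w \<in> tower ps x" "y = u + b w" by blast
    then have "r *\<^sub>R y = r *\<^sub>R u + b (r *\<^sub>R w)" "r *\<^sub>R u \<in> tower ps x" "r *\<^sub>R w \<in> tower ps x"
      by (simp_all add: blinfun.scaleR_right scaleR_add_right subspace_scale[OF Cons.IH])
    then show "r *\<^sub>R y \<in> {u + b w | u w. u \<in> tower ps x \<and> w \<in> tower ps x}" by blast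
  qed
qed simp

lemma tower_base: "x \<in> tower ps x"
proof (induction ps)
  case (Cons p ps)
  obtain a b where p: "p = (a, b)" by fastforce
  have "x = x + b 0" by (simp add: blinfun.zero_right)
  then show ?case using Cons.IH subspace_0[OF subspace_tower[of ps x]] unfolding p tower.simps by blast
qed (simp add: span_base)

lemma fixes_tower:
  assumes "\<forall>(p, q)\<in>set ps. commutes a q" "a x = x" "y \<in> tower ps x"
  shows "a y = y"
  using assms
proof (induction ps arbitrary: y)
  case Nil
  then obtain r where "y = r *\<^sub>R x" by (auto simp: span_singleton)
  then show ?case using Nil by (simp add: blinfun.scaleR_right)
next
  case (Cons p ps)
  obtain a' b' where p: "p = (a', b')" by fastforce
  from Cons.prems obtain u w where "u \<in> tower ps x" "w \<in> tower ps x" "y = u + b' w"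
    unfolding p by auto
  moreover have "a u = u" "a w = w" using Cons \<open>u \<in> _\<close> \<open>w \<in> _\<close> by auto
  ultimately show ?case using Cons.prems unfolding p
    by (simp add: blinfun.add_right commutes_def)
qed

lemma tower_preserved:
  assumes "matrix_pairs ps" "\<forall>(a, b)\<in>set ps. a x = x" "(a, b) \<in> set ps"
  shows "preserves a (tower ps x) \<and> preserves b (tower ps x)"
  using assms
proof (induction ps)
  case (Cons p ps)
  obtain a' b' where p: "p = (a', b')" by fastforce
  have pair: "matrix_pair (a', b')" and comm: "\<forall>p\<in>set ps. pairs_commute (a', b') p"
    and ps: "matrix_pairs ps"
    using Cons.prems(1) unfolding p matrix_pairs_Cons by auto
  note S = subspace_tower[of ps x]
  show ?case
  proof (cases "(a, b) = (a', b')")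
    case True
    have fix_a: "a' u = u" if "u \<in> tower ps x" for u
    proof (rule fixes_tower[OF _ _ that])
      show "\<forall>(p, q)\<in>set ps. commutes a' q" using comm by (auto simp: pairs_commute_def)
      show "a' x = x" using Cons.prems(2) by (simp add: p)
    qed
    have "\<exists>u' w'. z = u' + b' w' \<and> u' \<in> tower ps x \<and> w' \<in> tower ps x"
      if "z = a' (u + b' w) \<or> z = b' (u + b' w)" "u \<in> tower ps x" "w \<in> tower ps x" for z u w
      using that(1)
    proof
      assume "z = a' (u + b' w)"
      then have "z = u + b' (- w)"
        using pair fix_a that by (simp add: matrix_pair_def anticommutes_def blinfun.add_right
            blinfun.minus_right)
      then show ?thesis using that subspace_neg[OF S] by blast
    next
      assume "z = b' (u + b' w)"
      then have "z = w + b' u"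
        using pair by (simp add: matrix_pair_def involutive_def blinfun.add_right)
      then show ?thesis using that by blast
    qed
    then show ?thesis using True unfolding p preserves_def by fastforce
  next
    case False
    then have mem: "(a, b) \<in> set ps" using Cons.prems(3) unfolding p by simp blast
    then have IH: "preserves a (tower ps x)" "preserves b (tower ps x)"
      using Cons.IH[OF ps] Cons.prems(2) by auto
    have "commutes b' a" "commutes b' b" using comm mem by (auto simp: pairs_commute_def)
    then have "a (u + b' w) = a u + b' (a w)" "b (u + b' w) = b u + b' (b w)" for u w
      by (simp_all add: commutes_def blinfun.add_right)
    then show ?thesis using IH unfolding p preserves_def by auto blast+
  qed
qed simp

text \<open>
  On \<open>u + b w\<close>, with \<open>u\<close> and \<open>w\<close> fixed by \<open>a\<close>, the involution \<open>a\<close> acts as \<open>u - b w\<close>. So a fixed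
  vector of \<open>a\<close> has no component \<open>b w\<close>, and descends to the next smaller stage of the tower.
\<close>
lemma tower_fixed_vectors:
  assumes "matrix_pairs ps" "\<forall>(a, b)\<in>set ps. a x = x"
    and "y \<in> tower ps x" "\<forall>(a, b)\<in>set ps. a y = y"
  shows "y \<in> span {x}"
  using assms
proof (induction ps)
  case (Cons p ps)
  obtain a b where p: "p = (a, b)" by fastforce
  have pair: "matrix_pair (a, b)" and comm: "\<forall>p\<in>set ps. pairs_commute (a, b) p"
    and ps: "matrix_pairs ps"
    using Cons.prems(1) unfolding p matrix_pairs_Cons by auto
  obtain u w where uw: "u \<in> tower ps x" "w \<in> tower ps x" "y = u + b w"
    using Cons.prems(3) unfolding p by auto
  have "\<forall>(p, q)\<in>set ps. commutes a q" using comm by (auto simp: pairs_commute_def)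
  then have "a u = u" "a w = w"
    using fixes_tower uw Cons.prems(2) unfolding p by auto
  then have "y = u - b w"
    using Cons.prems(4) uw pair unfolding p
    by (simp add: matrix_pair_def anticommutes_def blinfun.add_right)
  then have "y + y = u + u" using uw(3) by (metis add_diff_cancel add_diff_eq diff_add_eq)
  then have "2 *\<^sub>R y = 2 *\<^sub>R u" by (simp add: scaleR_2)
  then have "y \<in> tower ps x" using uw(1) by simp
  then show ?case using Cons.IH ps Cons.prems by simp
qed simp

text \<open>
  The second member of a pair interchanges the eigenspaces of the first for the eigenvalues 1 and
  -1, and both members act on the common fixed vectors of the other pairs. So if \<open>x + a x\<close>
  vanishes, then \<open>b x\<close> is a nonzero fixed vector of \<open>a\<close>.
\<close>
lemma matrix_pairs_fixed_vector:
  assumes "matrix_pairs (ps :: 's::euclidean_space op_pair list)"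
  shows "\<exists>x. x \<noteq> 0 \<and> (\<forall>(a, b)\<in>set ps. a x = x)"
  using assms
proof (induction ps)
  case Nil
  show ?case using nonzero_Basis[OF SOME_Basis] by auto
next
  case (Cons p ps)
  obtain a b where p: "p = (a, b)" by fastforce
  have pair: "matrix_pair (a, b)" and comm: "\<forall>p\<in>set ps. pairs_commute (a, b) p"
    using Cons.prems unfolding p matrix_pairs_Cons by auto
  obtain x where x: "x \<noteq> 0" "\<forall>(a, b)\<in>set ps. a x = x"
    using Cons by (auto simp: p matrix_pairs_Cons)
  have swap: "p' (a z) = a (p' z)" "p' (b z) = b (p' z)" if "(p', q') \<in> set ps" for p' q' z
    using comm that by (auto simp: pairs_commute_def commutes_def)
  show ?case
  proof (cases "x + a x = 0")
    case False
    have "\<forall>(p', q')\<in>set (p # ps). p' (x + a x) = x + a x"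
      using pair x(2) swap by (auto simp: p matrix_pair_def involutive_def blinfun.add_right)
    then show ?thesis using False by blast
  next
    case True
    then have ax: "a x = - x" by (simp add: add_eq_0_iff)
    have "b (b x) \<noteq> 0" using pair x by (simp add: matrix_pair_def involutive_def)
    then have "b x \<noteq> 0" by (auto simp: blinfun.zero_right)
    moreover have "\<forall>(p', q')\<in>set (p # ps). p' (b x) = b x"
      using pair x(2) swap ax by (auto simp: p matrix_pair_def anticommutes_def blinfun.minus_right)
    ultimately show ?thesis by blast
  qed
qed

text \<open>
  By irreducibility the tower over a common fixed vector \<open>x\<close> is everything, so that \<open>x\<close> spans the
  common fixed vectors. The image \<open>T x\<close> is one of them, hence a multiple \<open>r x\<close>, and the eigenspace
  of \<open>T\<close> for \<open>r\<close> is a nonzero submodule.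
\<close>
lemma matrix_pairs_commutant:
  assumes ps: "matrix_pairs (ps :: 's::euclidean_space op_pair list)"
    and irred: "\<And>W. subspace W \<Longrightarrow> \<forall>(a, b)\<in>set ps. preserves a W \<and> preserves b W \<Longrightarrow>
      W = {0} \<or> W = UNIV"
    and T: "\<forall>(a, b)\<in>set ps. commutes T a \<and> commutes T b"
  shows "\<exists>r. T = r *\<^sub>R id_blinfun"
proof -
  obtain x where x: "x \<noteq> 0" "\<forall>(a, b)\<in>set ps. a x = x"
    using matrix_pairs_fixed_vector[OF ps] by blast
  have "tower ps x = UNIV"
    using irred[OF subspace_tower[of ps x]] tower_preserved[OF ps x(2)] tower_base[of x ps] x(1)
    by blast
  moreover have "\<forall>(a, b)\<in>set ps. a (T x) = T x"
  proof safe
    fix a b assume "(a, b) \<in> set ps"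
    then have "a x = x" "commutes T a" using x T by auto
    then show "a (T x) = T x" unfolding commutes_def by metis
  qed
  ultimately have "T x \<in> span {x}" using tower_fixed_vectors[OF ps x(2)] by blast
  then obtain r where r: "T x = r *\<^sub>R x" by (auto simp: span_singleton)
  define W where "W = {y. T y = r *\<^sub>R y}"
  have "subspace W"
    unfolding W_def by (rule subspaceI)
      (auto simp: blinfun.zero_right blinfun.add_right blinfun.scaleR_right scaleR_add_right
        scaleR_left_commute)
  moreover have "\<forall>(a, b)\<in>set ps. preserves a W \<and> preserves b W"
    using T by (auto simp: W_def preserves_def commutes_def blinfun.scaleR_right)
  moreover have "x \<in> W" using r by (simp add: W_def)
  ultimately have "W = UNIV" using irred x(1) by blast
  then have "T = r *\<^sub>R id_blinfun"
    by (intro blinfun_eqI) (auto simp: W_def blinfun.scaleR_left)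
  then show ?thesis by blast
qed

section \<open>Clifford algebras on 8k generators are real matrix algebras\<close>

lemma commutes_compose: "commutes t a \<Longrightarrow> commutes t b \<Longrightarrow> commutes t (a o\<^sub>L b)"
  by (simp add: commutes_def)

lemma preserves_compose: "preserves a W \<Longrightarrow> preserves b W \<Longrightarrow> preserves (a o\<^sub>L b) W"
  by (simp add: preserves_def)

text \<open>
  Read from left to right, these equations rewrite every product of the eight generators to a signed
  product of distinct generators in increasing order.
\<close>
lemma anticommuting_involutions_normal_form:
  assumes anti: "sorted_wrt anticommutes [e1, e2, e3, e4, e5, e6, e7, e8]"
    and inv: "\<forall>e\<in>set [e1, e2, e3, e4, e5, e6, e7, e8]. involutive e"
  shows
    "e2 (e1 x) = - e1 (e2 x)"
    "e3 (e1 x) = - e1 (e3 x)" "e3 (e2 x) = - e2 (e3 x)"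
    "e4 (e1 x) = - e1 (e4 x)" "e4 (e2 x) = - e2 (e4 x)" "e4 (e3 x) = - e3 (e4 x)"
    "e5 (e1 x) = - e1 (e5 x)" "e5 (e2 x) = - e2 (e5 x)" "e5 (e3 x) = - e3 (e5 x)"
    "e5 (e4 x) = - e4 (e5 x)"
    "e6 (e1 x) = - e1 (e6 x)" "e6 (e2 x) = - e2 (e6 x)" "e6 (e3 x) = - e3 (e6 x)"
    "e6 (e4 x) = - e4 (e6 x)" "e6 (e5 x) = - e5 (e6 x)"
    "e7 (e1 x) = - e1 (e7 x)" "e7 (e2 x) = - e2 (e7 x)" "e7 (e3 x) = - e3 (e7 x)"
    "e7 (e4 x) = - e4 (e7 x)" "e7 (e5 x) = - e5 (e7 x)" "e7 (e6 x) = - e6 (e7 x)"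
    "e8 (e1 x) = - e1 (e8 x)" "e8 (e2 x) = - e2 (e8 x)" "e8 (e3 x) = - e3 (e8 x)"
    "e8 (e4 x) = - e4 (e8 x)" "e8 (e5 x) = - e5 (e8 x)" "e8 (e6 x) = - e6 (e8 x)"
    "e8 (e7 x) = - e7 (e8 x)"
    "e1 (e1 x) = x" "e2 (e2 x) = x" "e3 (e3 x) = x" "e4 (e4 x) = x"
    "e5 (e5 x) = x" "e6 (e6 x) = x" "e7 (e7 x) = x" "e8 (e8 x) = x"
  using anti inv by (simp_all add: anticommutes_def involutive_def)

text \<open>
  The four pairs come from splitting off two generators at a time. The pair \<open>e1, e2\<close> generates a
  2 by 2 matrix algebra commuting with the \<open>e1 e2 em\<close> for \<open>m \<ge> 3\<close>, which again anticommute but have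
  square -1. Two of these, \<open>i = e1 e2 e3\<close> and \<open>j = e1 e2 e4\<close>, generate the quaternions, with third
  unit \<open>k = e3 e4\<close> up to sign. They commute with the \<open>e1 e2 e3 e4 em\<close> for \<open>m \<ge> 5\<close>, whose square
  is 1, so that \<open>m = 5, 6\<close> give another matrix pair. The last two generators give a second copy
  of the quaternions, spanned by 1 and, up to sign, \<open>i' = e1 e2 e3 e4 e5 e6 e7\<close>,
  \<open>j' = e1 e2 e3 e4 e5 e6 e8\<close> and \<open>k' = e7 e8\<close>. The tensor product of two copies of the quaternions
  is a 4 by 4 matrix algebra, generated by the commuting matrix pairs \<open>(i i', j i')\<close> and
  \<open>(k j', k k')\<close>, which are, up to sign, the last two pairs below.
\<close>
lemma matrix_pairs_of_eight:
  assumes anti: "sorted_wrt anticommutes [e1, e2, e3, e4, e5, e6, e7, e8]"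
    and inv: "\<forall>e\<in>set [e1, e2, e3, e4, e5, e6, e7, e8]. involutive e"
  defines "ps \<equiv> [(e1, e2),
    (e1 o\<^sub>L e2 o\<^sub>L e3 o\<^sub>L e4 o\<^sub>L e5, e1 o\<^sub>L e2 o\<^sub>L e3 o\<^sub>L e4 o\<^sub>L e6),
    (e4 o\<^sub>L e5 o\<^sub>L e6 o\<^sub>L e7, e3 o\<^sub>L e5 o\<^sub>L e6 o\<^sub>L e7),
    (e1 o\<^sub>L e2 o\<^sub>L e5 o\<^sub>L e6 o\<^sub>L e8, e3 o\<^sub>L e4 o\<^sub>L e7 o\<^sub>L e8)]"
  shows "matrix_pairs ps"
    and "\<forall>e\<in>set [e1, e2, e3, e4, e5, e6, e7, e8]. commutes t e \<Longrightarrow>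
      \<forall>(a, b)\<in>set ps. commutes t a \<and> commutes t b"
    and "subspace W \<Longrightarrow> \<forall>(a, b)\<in>set ps. preserves a W \<and> preserves b W \<Longrightarrow>
      \<forall>e\<in>set [e1, e2, e3, e4, e5, e6, e7, e8]. preserves e W"
proof -
  note sort = anticommuting_involutions_normal_form[OF anti inv]
  show "matrix_pairs ps"
    by (simp add: ps_def matrix_pairs_def matrix_pair_def pairs_commute_def commutes_def
        anticommutes_def involutive_def sort blinfun.minus_right)
  show "\<forall>(a, b)\<in>set ps. commutes t a \<and> commutes t b"
    if "\<forall>e\<in>set [e1, e2, e3, e4, e5, e6, e7, e8]. commutes t e"
    using that by (simp add: ps_def commutes_compose)
  assume W: "subspace W" and pres: "\<forall>(a, b)\<in>set ps. preserves a W \<and> preserves b W"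
  obtain a1 b1 a2 b2 a3 b3 a4 b4 where word: "a1 = e1" "b1 = e2" "a2 = e1 o\<^sub>L e2 o\<^sub>L e3 o\<^sub>L e4 o\<^sub>L e5"
    "b2 = e1 o\<^sub>L e2 o\<^sub>L e3 o\<^sub>L e4 o\<^sub>L e6" "a3 = e4 o\<^sub>L e5 o\<^sub>L e6 o\<^sub>L e7"
    "b3 = e3 o\<^sub>L e5 o\<^sub>L e6 o\<^sub>L e7" "a4 = e1 o\<^sub>L e2 o\<^sub>L e5 o\<^sub>L e6 o\<^sub>L e8"
    "b4 = e3 o\<^sub>L e4 o\<^sub>L e7 o\<^sub>L e8"
    by blast
  have ab: "ps = [(a1, b1), (a2, b2), (a3, b3), (a4, b4)]"
    by (simp add: ps_def word)
  have mem: "a1 x \<in> W" "b1 x \<in> W" "a2 x \<in> W" "b2 x \<in> W" "a3 x \<in> W" "b3 x \<in> W" "a4 x \<in> W" "b4 x \<in> W"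
    if "x \<in> W" for x
    using pres that by (auto simp: ab preserves_def)
  have minus: "- x \<in> W \<longleftrightarrow> x \<in> W" for x
    using subspace_neg[OF W, of x] subspace_neg[OF W, of "-x"] by auto
  show "\<forall>e\<in>set [e1, e2, e3, e4, e5, e6, e7, e8]. preserves e W"
    unfolding preserves_def
  proof (intro ballI)
    fix e x assume "e \<in> set [e1, e2, e3, e4, e5, e6, e7, e8]" and x: "x \<in> W"
    \<comment> \<open>The index sets of the members of the pairs form a basis of the subsets of \<open>{1..8}\<close> as a vector
      space over the field with two elements. Each word below multiplies members whose
      index sets add up to a singleton, and so equals a generator up to sign.\<close>
    have "a1 (b1 (a2 (a3 (b3 x)))) \<in> W" "a1 (b1 (b2 (a3 (b3 x)))) \<in> W"
      "a1 (b1 (a2 (b2 (a4 x)))) \<in> W" "b4 (a3 (b3 (a1 (b1 (a2 (b2 (a4 x))))))) \<in> W"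
      "a3 (a2 (b2 (b4 (a3 (b3 (a1 (b1 (a2 (b2 (a4 x)))))))))) \<in> W"
      "b3 (a2 (b2 (b4 (a3 (b3 (a1 (b1 (a2 (b2 (a4 x)))))))))) \<in> W"
      "a1 x \<in> W" "b1 x \<in> W"
      using x by (auto intro!: mem)
    then have "e1 x \<in> W \<and> e2 x \<in> W \<and> e3 x \<in> W \<and> e4 x \<in> W \<and> e5 x \<in> W \<and> e6 x \<in> W \<and> e7 x \<in> W \<and> e8 x \<in> W"
      by (simp add: word sort blinfun.minus_right minus)
    then show "e x \<in> W" using \<open>e \<in> _\<close> by auto
  qed
qed

lemma commutes_sym: "commutes a b \<Longrightarrow> commutes b a"
  by (simp add: commutes_def)

text \<open>
  The product \<open>w\<close> of the first eight generators is an involution that anticommutes with these and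
  commutes with the others. Multiplying the other generators by \<open>w\<close> yields anticommuting
  involutions that commute with the first eight, so that the induction hypothesis applied to
  them gives pairs that commute with the pairs of the first eight.

  The last two clauses are what is used of the fact that the pairs and the given involutions
  generate the same algebra.
\<close>
lemma matrix_pairs_of_involutions:
  assumes "length L = 8 * k" "sorted_wrt anticommutes L"
    and "\<forall>e\<in>set L. involutive (e :: 's::euclidean_space \<Rightarrow>\<^sub>L 's)"
  shows "\<exists>ps. matrix_pairs ps \<and>
    (\<forall>t. (\<forall>e\<in>set L. commutes t e) \<longrightarrow> (\<forall>(a, b)\<in>set ps. commutes t a \<and> commutes t b)) \<and>
    (\<forall>W. subspace W \<longrightarrow> (\<forall>(a, b)\<in>set ps. preserves a W \<and> preserves b W) \<longrightarrow>
      (\<forall>e\<in>set L. preserves e W))"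
  using assms
proof (induction k arbitrary: L)
  case 0
  then show ?case by (intro exI[of _ "[]"]) (simp add: matrix_pairs_def)
next
  case (Suc k)
  obtain e1 e2 e3 e4 e5 e6 e7 e8 L' where L: "L = [e1, e2, e3, e4, e5, e6, e7, e8] @ L'"
    and len: "length L' = 8 * k"
    using Suc.prems(1) by (auto simp: length_Suc_conv numeral_eq_Suc)
  let ?es = "[e1, e2, e3, e4, e5, e6, e7, e8]"
  have es: "sorted_wrt anticommutes ?es" "\<forall>e\<in>set ?es. involutive e"
    and anti': "sorted_wrt anticommutes L'" and inv': "\<forall>a\<in>set L'. involutive a"
    and anti: "\<forall>e\<in>set ?es. \<forall>a\<in>set L'. anticommutes e a"
    using Suc.prems(2,3) unfolding L sorted_wrt_append by simp_all
  note sort = anticommuting_involutions_normal_form[OF es]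
  define w where "w = e1 o\<^sub>L e2 o\<^sub>L e3 o\<^sub>L e4 o\<^sub>L e5 o\<^sub>L e6 o\<^sub>L e7 o\<^sub>L e8"
  have w_w: "w (w x) = x" for x
    by (simp add: w_def sort blinfun.minus_right)
  have w_a: "w (a x) = a (w x)" if "a \<in> set L'" for a x
  proof -
    have "e (a y) = - a (e y)" if "e \<in> set ?es" for e y
      using anti that \<open>a \<in> set L'\<close> unfolding anticommutes_def by blast
    then show ?thesis by (simp add: w_def blinfun.minus_right)
  qed
  have w_e: "w (e x) = - e (w x)" if "e \<in> set ?es" for e x
    using that by (auto simp: w_def sort blinfun.minus_right)
  let ?L = "map (\<lambda>a. w o\<^sub>L a) L'"
  have anti_w: "anticommutes (w o\<^sub>L a) (w o\<^sub>L a')"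
    if "a \<in> set L'" "a' \<in> set L'" "anticommutes a a'" for a a'
    using that(3) w_a[OF that(1)] w_a[OF that(2)]
    by (simp add: anticommutes_def w_w blinfun.minus_right)
  have anti_L: "sorted_wrt anticommutes ?L"
    unfolding sorted_wrt_map
    by (rule sorted_wrt_mono_rel[OF _ anti']) (simp add: anti_w)
  have inv_L: "\<forall>e\<in>set ?L. involutive e"
    using inv' w_a by (simp add: involutive_def w_w)
  have len_L: "length ?L = 8 * k" using len by simp
  obtain qs where qs: "matrix_pairs qs"
    and comm: "\<forall>t. (\<forall>e\<in>set ?L. commutes t e) \<longrightarrow> (\<forall>(a, b)\<in>set qs. commutes t a \<and> commutes t b)"
    and pres: "\<forall>W. subspace W \<longrightarrow> (\<forall>(a, b)\<in>set qs. preserves a W \<and> preserves b W) \<longrightarrow>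
      (\<forall>e\<in>set ?L. preserves e W)"
    using Suc.IH[OF len_L anti_L inv_L] by (elim exE conjE) (rule that)
  define ps where "ps = [(e1, e2),
    (e1 o\<^sub>L e2 o\<^sub>L e3 o\<^sub>L e4 o\<^sub>L e5, e1 o\<^sub>L e2 o\<^sub>L e3 o\<^sub>L e4 o\<^sub>L e6),
    (e4 o\<^sub>L e5 o\<^sub>L e6 o\<^sub>L e7, e3 o\<^sub>L e5 o\<^sub>L e6 o\<^sub>L e7),
    (e1 o\<^sub>L e2 o\<^sub>L e5 o\<^sub>L e6 o\<^sub>L e8, e3 o\<^sub>L e4 o\<^sub>L e7 o\<^sub>L e8)]"
  note ps = matrix_pairs_of_eight[OF es, folded ps_def]
  have "commutes e (w o\<^sub>L a)" if "e \<in> set ?es" "a \<in> set L'" for e a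
  proof -
    have "e (a x) = - a (e x)" for x using anti that unfolding anticommutes_def by blast
    moreover have "e (w x) = - w (e x)" for x using w_e[OF that(1)] by simp
    ultimately show ?thesis by (simp add: commutes_def blinfun.minus_right)
  qed
  then have "\<forall>e\<in>set ?L. commutes e' e" if "e' \<in> set ?es" for e'
    using that by simp
  then have "\<forall>e\<in>set ?es. \<forall>(p, q)\<in>set qs. commutes e p \<and> commutes e q"
    using comm by blast
  then have es_qs: "\<forall>e\<in>set ?es. commutes p e" "\<forall>e\<in>set ?es. commutes q e" if "(p, q) \<in> set qs" for p q
    using that commutes_sym by blast+
  have "pairs_commute x y" if "x \<in> set ps" "y \<in> set qs" for x y
  proof -
    obtain a b p q where xy: "x = (a, b)" "y = (p, q)" by fastforce
    have "commutes p a" "commutes p b" "commutes q a" "commutes q b"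
      using ps(2)[OF es_qs(1)] ps(2)[OF es_qs(2)] that unfolding xy by blast+
    then show ?thesis by (simp add: xy pairs_commute_def commutes_sym)
  qed
  then have "matrix_pairs (ps @ qs)"
    using ps(1) qs unfolding matrix_pairs_def sorted_wrt_append set_append by blast
  moreover have "\<forall>(a, b)\<in>set (ps @ qs). commutes t a \<and> commutes t b"
    if t: "\<forall>e\<in>set L. commutes t e" for t
  proof -
    have te: "\<forall>e\<in>set ?es. commutes t e" using t by (simp add: L)
    then have "commutes t w" unfolding w_def by (intro commutes_compose) auto
    then have "\<forall>e\<in>set ?L. commutes t e" using t by (auto simp: L intro: commutes_compose)
    then have "\<forall>(a, b)\<in>set qs. commutes t a \<and> commutes t b" using comm by blast
    then show ?thesis using ps(2)[OF te] unfolding set_append by blast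
  qed
  moreover have "\<forall>e\<in>set L. preserves e W"
    if W: "subspace W" and pr: "\<forall>(a, b)\<in>set (ps @ qs). preserves a W \<and> preserves b W" for W
  proof -
    have es_W: "\<forall>e\<in>set ?es. preserves e W" using ps(3)[OF W] pr by simp
    then have w_W: "preserves w W" unfolding w_def by (intro preserves_compose) auto
    have "preserves a W" if "a \<in> set L'" for a
    proof -
      have "\<forall>e\<in>set ?L. preserves e W" using pres W pr by simp
      then have "preserves (w o\<^sub>L a) W" using that by simp
      then have "preserves (w o\<^sub>L (w o\<^sub>L a)) W" using w_W by (rule preserves_compose[rotated])
      moreover have "w o\<^sub>L (w o\<^sub>L a) = a" by (rule blinfun_eqI) (simp add: w_w)
      ultimately show ?thesis by simp
    qed
    then show ?thesis using es_W by (auto simp: L)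
  qed
  ultimately show ?case by blast
qed

section \<open>Clifford modules and the volume element\<close>

lemma clifford_linear: "clifford_module c \<Longrightarrow> linear c"
  by (simp add: clifford_module_def)

lemma clifford_square:
  assumes "clifford_module c"
  shows "c v (c v x) = (v \<bullet> v) *\<^sub>R x"
proof -
  have "(c v o\<^sub>L c v) x = ((- ip v v) *\<^sub>R id_blinfun) x"
    using assms by (simp add: clifford_module_def)
  then show ?thesis by (simp add: ip_def blinfun.scaleR_left)
qed

lemma clifford_relation:
  assumes c: "clifford_module c"
  shows "c v (c w x) + c w (c v x) = (2 * (v \<bullet> w)) *\<^sub>R x"
proof -
  have "c (v + w) (c (v + w) x) = (v \<bullet> v) *\<^sub>R x + (w \<bullet> w) *\<^sub>R x + (c v (c w x) + c w (c v x))"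
    by (simp add: linear_add[OF clifford_linear[OF c]] blinfun.add_left blinfun.add_right
        clifford_square[OF c])
  moreover have "c (v + w) (c (v + w) x) = (v \<bullet> v) *\<^sub>R x + (w \<bullet> w) *\<^sub>R x + (2 * (v \<bullet> w)) *\<^sub>R x"
    by (simp add: clifford_square[OF c] inner_add inner_commute[of w v] algebra_simps)
  ultimately show ?thesis by simp
qed

lemma clifford_anticommutes:
  assumes "clifford_module c" "v \<bullet> w = 0"
  shows "anticommutes (c v) (c w)"
  using clifford_relation[OF assms(1), of v w] assms(2)
  by (simp add: anticommutes_def eq_neg_iff_add_eq_0)

lemma orthonormal_basis_sorted:
  assumes "orthonormal_basis es"
  shows "sorted_wrt (\<lambda>x y. x \<bullet> y = 0) es" "\<forall>e\<in>set es. e \<bullet> e = 1"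
proof -
  have ip: "es ! i \<bullet> es ! j = (if i = j then 1 else 0)" if "i < length es" "j < length es" for i j
    using assms that unfolding orthonormal_basis_def ip_def by (auto split: if_splits)
  show "sorted_wrt (\<lambda>x y. x \<bullet> y = 0) es" "\<forall>e\<in>set es. e \<bullet> e = 1"
    using ip by (auto simp: sorted_wrt_iff_nth_less in_set_conv_nth)
qed

lemma orthonormal_basis_span:
  assumes "orthonormal_basis (es :: 'e::euclidean_space list)"
  shows "span (set es) = UNIV"
proof -
  have ip: "es ! i \<bullet> es ! j = (if i = j then 1 else 0)" if "i < length es" "j < length es" for i j
    using assms that unfolding orthonormal_basis_def ip_def by (auto split: if_splits)
  have "distinct es"
    unfolding distinct_conv_nth using ip by (metis zero_neq_one)
  then have card: "card (set es) = DIM('e)"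
    using assms by (simp add: distinct_card orthonormal_basis_def)
  have "pairwise orthogonal (set es)"
  proof (rule pairwiseI)
    fix x y assume "x \<in> set es" "y \<in> set es" "x \<noteq> y"
    then show "orthogonal x y" using ip by (auto simp: in_set_conv_nth orthogonal_def)
  qed
  moreover have "0 \<notin> set es"
    using ip by (metis in_set_conv_nth inner_zero_left zero_neq_one)
  ultimately have "independent (set es)" by (rule pairwise_orthogonal_independent)
  then show ?thesis using card by (metis card_eq_dim dim_UNIV span_UNIV subset_UNIV
        card_ge_dim_independent dual_order.refl subset_antisym top_greatest)
qed

text \<open>
  The matrix pairs of an orthonormal basis have the same invariant subspaces as the module, so
  that they act irreducibly.
\<close>
lemma clifford_commutant:
  fixes c :: "'e::euclidean_space \<Rightarrow> 's::euclidean_space \<Rightarrow>\<^sub>L 's"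
  assumes dim: "DIM('e) mod 8 = 0" and c: "irreducible_clifford_module c"
    and es: "orthonormal_basis (es :: 'e list)" and t: "\<And>v. commutes t (c v)"
  shows "\<exists>r. t = r *\<^sub>R id_blinfun"
proof -
  have cm: "clifford_module c" using c by (simp add: irreducible_clifford_module_def)
  let ?L = "map c es"
  obtain k where len: "length ?L = 8 * k"
    using dim es by (auto simp: orthonormal_basis_def)
  have "sorted_wrt anticommutes ?L"
    unfolding sorted_wrt_map
    by (rule sorted_wrt_mono_rel[OF _ orthonormal_basis_sorted(1)[OF es]])
      (simp add: clifford_anticommutes[OF cm])
  moreover have "\<forall>e\<in>set ?L. involutive e"
    using orthonormal_basis_sorted(2)[OF es] by (simp add: involutive_def clifford_square[OF cm])
  ultimately obtain ps where ps: "matrix_pairs ps"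
    and comm: "\<And>t. \<forall>e\<in>set ?L. commutes t e \<Longrightarrow> \<forall>(a, b)\<in>set ps. commutes t a \<and> commutes t b"
    and pres: "\<And>W. subspace W \<Longrightarrow> \<forall>(a, b)\<in>set ps. preserves a W \<and> preserves b W \<Longrightarrow>
      \<forall>e\<in>set ?L. preserves e W"
    using matrix_pairs_of_involutions[OF len] by blast
  show ?thesis
  proof (rule matrix_pairs_commutant[OF ps])
    fix W :: "'s set"
    assume W: "subspace W" "\<forall>(a, b)\<in>set ps. preserves a W \<and> preserves b W"
    have "c v x \<in> W" if "x \<in> W" for v x
    proof -
      have "subspace {v. c v x \<in> W}"
        using clifford_linear[OF cm] W(1)
        by (intro subspaceI) (simp_all add: linear_0 linear_add linear_cmul blinfun.add_left
            blinfun.scaleR_left subspace_0 subspace_add subspace_scale)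
      moreover have "set es \<subseteq> {v. c v x \<in> W}"
        using pres[OF W] that by (auto simp: preserves_def)
      ultimately show ?thesis
        using span_minimal orthonormal_basis_span[OF es] by blast
    qed
    then show "W = {0} \<or> W = UNIV" using c W(1) by (auto simp: irreducible_clifford_module_def)
  next
    show "\<forall>(a, b)\<in>set ps. commutes t a \<and> commutes t b" by (rule comm) (simp add: t)
  qed
qed

lemma volume_action_Cons: "volume_action c (e # es) x = c e (volume_action c es x)"
  by (simp add: volume_action_def)

lemma volume_action_Nil: "volume_action c [] x = x"
  by (simp add: volume_action_def)

lemma volume_action_orthogonal:
  assumes "clifford_module c" "\<forall>e\<in>set es. e \<bullet> v = 0"
  shows "volume_action c es (c v x) = (-1) ^ length es *\<^sub>R c v (volume_action c es x)"
  using assms(2)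
proof (induction es)
  case (Cons e es)
  have "c e (c v y) = - c v (c e y)" for y
    using clifford_anticommutes[OF assms(1), of e v] Cons.prems by (simp add: anticommutes_def)
  then show ?case using Cons by (simp add: volume_action_Cons blinfun.scaleR_right)
qed (simp add: volume_action_Nil)

text \<open>
  Moving a vector through the volume product costs a sign for every factor except the vector itself.
\<close>
lemma volume_action_member:
  assumes c: "clifford_module c" and es: "sorted_wrt (\<lambda>x y. x \<bullet> y = 0) es"
    and v: "v \<in> set es"
  shows "volume_action c es (c v x) = - ((-1) ^ length es) *\<^sub>R c v (volume_action c es x)"
  using es v
proof (induction es)
  case (Cons e es)
  show ?case
  proof (cases "v = e")
    case True
    have "\<forall>e'\<in>set es. e' \<bullet> v = 0" using Cons.prems True by (simp add: inner_commute)
    then show ?thesis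
      using True volume_action_orthogonal[OF c] by (simp add: volume_action_Cons blinfun.scaleR_right)
  next
    case False
    then have mem: "v \<in> set es" "e \<bullet> v = 0" using Cons.prems by auto
    have "c e (c v y) = - c v (c e y)" for y
      using clifford_anticommutes[OF c mem(2)] by (simp add: anticommutes_def)
    then show ?thesis using Cons mem
      by (simp add: volume_action_Cons blinfun.scaleR_right blinfun.minus_right)
  qed
qed simp

lemma volume_action_square:
  assumes c: "clifford_module c" and "sorted_wrt (\<lambda>x y. x \<bullet> y = 0) es" "\<forall>e\<in>set es. e \<bullet> e = 1"
  shows "volume_action c es (volume_action c es x) = (-1) ^ (length es choose 2) *\<^sub>R x"
  using assms(2,3)
proof (induction es arbitrary: x)
  case (Cons e es)
  have "\<forall>e'\<in>set es. e' \<bullet> e = 0" using Cons.prems by (simp add: inner_commute)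
  then show ?case
    using Cons volume_action_orthogonal[OF c] clifford_square[OF c, of e]
    by (simp add: volume_action_Cons blinfun.scaleR_right numeral_2_eq_2 power_add)
qed (simp add: volume_action_Nil numeral_2_eq_2)

lemma volume_action_basis:
  fixes c :: "'e::euclidean_space \<Rightarrow> 's::euclidean_space \<Rightarrow>\<^sub>L 's"
  assumes c: "clifford_module c" and es: "orthonormal_basis es"
  shows "even DIM('e) \<Longrightarrow> anticommutes (volume_action c es) (c v)"
    and "4 dvd DIM('e) \<Longrightarrow> involutive (volume_action c es)"
proof -
  have len: "length es = DIM('e)" using es by (simp add: orthonormal_basis_def)
  note sorted = orthonormal_basis_sorted[OF es]
  let ?V = "{v. \<forall>x. volume_action c es (c v x) = - c v (volume_action c es x)}"
  show "anticommutes (volume_action c es) (c v)" if "even DIM('e)"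
  proof -
    have "subspace ?V"
      using clifford_linear[OF c]
      by (intro subspaceI) (simp_all add: linear_0 linear_add linear_cmul blinfun.add_left
            blinfun.scaleR_left blinfun.add_right blinfun.scaleR_right blinfun.zero_right)
    moreover have "set es \<subseteq> ?V"
      using volume_action_member[OF c sorted(1)] that len by auto
    ultimately have "?V = UNIV" using span_minimal orthonormal_basis_span[OF es] by blast
    then show ?thesis by (auto simp: anticommutes_def)
  qed
  show "involutive (volume_action c es)" if "4 dvd DIM('e)"
  proof -
    obtain k where "DIM('e) = 4 * k" using \<open>4 dvd DIM('e)\<close> by (rule dvdE)
    then have "DIM('e) choose 2 = 2 * (k * (4 * k - 1))" by (simp add: choose_two)
    then have "even (length es choose 2)" using len by simp
    then show ?thesis using volume_action_square[OF c sorted] by (simp add: involutive_def)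
  qed
qed

section \<open>Endomorphisms intertwined by Clifford multiplication\<close>

lemmas blinfun_simps = blinfun.add_left blinfun.add_right blinfun.diff_left blinfun.diff_right
  blinfun.minus_left blinfun.minus_right blinfun.scaleR_left blinfun.scaleR_right
  blinfun.zero_left blinfun.zero_right

text \<open>
  The properties of irreducible modules in dimension divisible by 8 on which the classification of
  spin representations rests.
\<close>
locale volume_module =
  fixes c :: "'e::euclidean_space \<Rightarrow> 's::euclidean_space \<Rightarrow>\<^sub>L 's" and \<omega> :: "'s \<Rightarrow>\<^sub>L 's"
  assumes clifford: "clifford_module c"
    and volume_involutive: "involutive \<omega>"
    and volume_anticommutes: "anticommutes \<omega> (c v)"
    and scalar_commutant: "(\<And>v. commutes t (c v)) \<Longrightarrow> \<exists>r. t = r *\<^sub>R id_blinfun"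
begin

lemma volume_square: "\<omega> (\<omega> x) = x"
  using volume_involutive by (simp add: involutive_def)

lemma volume_vector: "\<omega> (c v x) = - c v (\<omega> x)"
  using volume_anticommutes by (simp add: anticommutes_def)

lemma vector_orthogonal: "v \<bullet> w = 0 \<Longrightarrow> c v (c w x) = - c w (c v x)"
  using clifford_anticommutes[OF clifford] by (simp add: anticommutes_def)

lemma vector_unit: "f \<bullet> f = 1 \<Longrightarrow> c f (c f x) = x"
  using clifford_square[OF clifford, of f] by simp

lemma commutes_all_vectors:
  assumes "f \<bullet> f = 1" "commutes t (c f)" "\<And>v. v \<bullet> f = 0 \<Longrightarrow> commutes t (c v)"
  shows "commutes t (c v)"
proof -
  have lin: "linear c" by (rule clifford_linear[OF clifford])
  have v: "v = (v \<bullet> f) *\<^sub>R f + (v - (v \<bullet> f) *\<^sub>R f)" by simp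
  have "(v - (v \<bullet> f) *\<^sub>R f) \<bullet> f = 0" using assms(1) by (simp add: inner_diff_left)
  then have "commutes t (c (v - (v \<bullet> f) *\<^sub>R f))" by (rule assms(3))
  then show ?thesis
    using assms(2) by (subst v, subst linear_add[OF lin], subst linear_cmul[OF lin])
      (simp add: commutes_def blinfun_simps)
qed

text \<open>
  Split \<open>M\<close> into the parts that commute and anticommute with \<open>f\<close>; both still commute with the
  orthogonal complement of \<open>f\<close>. The first part then commutes with all vectors. So does the second part
  times \<open>f \<omega>\<close>, because \<open>f \<omega>\<close> anticommutes with \<open>f\<close> and commutes with the orthogonal complement.
  Both are therefore scalars.
\<close>
lemma commutant_of_orthogonal_complement:
  assumes f: "f \<bullet> f = 1" and M: "\<And>v. v \<bullet> f = 0 \<Longrightarrow> commutes M (c v)"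
  obtains \<alpha> \<delta> where "\<And>x. M x = \<alpha> *\<^sub>R x + \<delta> *\<^sub>R c f (\<omega> x)"
proof -
  let ?F = "c f"
  note FF = vector_unit[OF f]
  have Mv: "M (c v x) = c v (M x)" if "v \<bullet> f = 0" for v x
    using M[OF that] by (simp add: commutes_def)
  have Fv: "?F (c v x) = - c v (?F x)" if "v \<bullet> f = 0" for v x
    using vector_orthogonal[of f v] that by (simp add: inner_commute)
  define X where "X = M + (?F o\<^sub>L M o\<^sub>L ?F)"
  define Y where "Y = (M - (?F o\<^sub>L M o\<^sub>L ?F)) o\<^sub>L ?F o\<^sub>L \<omega>"
  have "commutes X (c v)" for v
  proof (rule commutes_all_vectors[OF f])
    show "commutes X ?F" by (simp add: X_def commutes_def blinfun_simps FF add.commute)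
    show "commutes X (c v)" if "v \<bullet> f = 0" for v
      using that by (simp add: X_def commutes_def blinfun_simps Mv Fv)
  qed
  then obtain r where r: "X = r *\<^sub>R id_blinfun" using scalar_commutant by blast
  have "commutes Y (c v)" for v
  proof (rule commutes_all_vectors[OF f])
    show "commutes Y ?F"
      by (simp add: Y_def commutes_def blinfun_simps FF volume_vector)
    show "commutes Y (c v)" if "v \<bullet> f = 0" for v
      using that by (simp add: Y_def commutes_def blinfun_simps Mv Fv volume_vector)
  qed
  then obtain s where s: "Y = s *\<^sub>R id_blinfun" using scalar_commutant by blast
  have "M x = (r / 2) *\<^sub>R x + (- s / 2) *\<^sub>R ?F (\<omega> x)" for x
  proof -
    have sum: "M x + ?F (M (?F x)) = r *\<^sub>R x"
      using arg_cong[OF r, of "\<lambda>T. blinfun_apply T x"] by (simp add: X_def blinfun_simps)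
    have diff: "M x - ?F (M (?F x)) = - s *\<^sub>R ?F (\<omega> x)"
      using arg_cong[OF s, of "\<lambda>T. blinfun_apply T (\<omega> (?F x))"]
      by (simp add: Y_def blinfun_simps FF volume_square volume_vector)
    have "M x = (1/2) *\<^sub>R ((M x + ?F (M (?F x))) + (M x - ?F (M (?F x))))"
      by (simp add: scaleR_2[symmetric])
    then show ?thesis unfolding sum diff by (simp add: scaleR_add_right scaleR_diff_right)
  qed
  then show ?thesis by (rule that)
qed

text \<open>
  Conjugation by a unit vector fixes \<open>1\<close> and changes the sign of \<open>\<omega>\<close>.
\<close>
lemma scalar_volume_independent:
  assumes eq: "\<And>x. a *\<^sub>R x + b *\<^sub>R \<omega> x = 0"
  shows "a = 0 \<and> b = 0"
proof -
  obtain v :: 'e where "v \<in> Basis" using nonempty_Basis by blast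
  then have v: "v \<bullet> v = 1" by (simp add: inner_Basis)
  obtain x :: 's where x: "x \<noteq> 0" using nonzero_Basis[OF SOME_Basis] by blast
  have "c v (a *\<^sub>R c v x + b *\<^sub>R \<omega> (c v x)) = a *\<^sub>R x - b *\<^sub>R \<omega> x"
    by (simp add: blinfun_simps volume_vector vector_unit[OF v])
  then have diff: "a *\<^sub>R x - b *\<^sub>R \<omega> x = 0" using eq[of "c v x"] by (simp add: blinfun_simps)
  have "(a + a) *\<^sub>R x = (a *\<^sub>R x + b *\<^sub>R \<omega> x) + (a *\<^sub>R x - b *\<^sub>R \<omega> x)"
    unfolding scaleR_add_left by simp
  then have "a = 0" unfolding diff eq using x by simp
  moreover have "\<omega> x \<noteq> 0" using x volume_square[of x] by (auto simp: blinfun_simps)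
  ultimately show ?thesis using eq[of x] by simp
qed

text \<open>
  Conjugation by \<open>f\<close> changes the sign of \<open>\<omega>\<close> only, and conjugation by a vector orthogonal to \<open>f\<close>
  changes the signs of both \<open>\<omega>\<close> and \<open>f\<close>, so that the three operators are separated by characters.
\<close>
lemma scalar_volume_vector_independent:
  assumes f: "f \<bullet> f = 1" and dim: "2 \<le> DIM('e)"
    and eq: "\<And>x. a *\<^sub>R x + b *\<^sub>R \<omega> x + k *\<^sub>R c f x = 0"
  shows "a = 0 \<and> b = 0 \<and> k = 0"
proof -
  obtain u where u: "u \<noteq> 0" "u \<bullet> f = 0"
    using orthogonal_to_vector_exists[OF dim, of f] by (auto simp: orthogonal_def inner_commute)
  have minus: "a *\<^sub>R x - b *\<^sub>R \<omega> x + k *\<^sub>R c f x = 0" for x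
  proof -
    have "a *\<^sub>R x - b *\<^sub>R \<omega> x + k *\<^sub>R c f x =
        c f (a *\<^sub>R c f x + b *\<^sub>R \<omega> (c f x) + k *\<^sub>R c f (c f x))"
      by (simp add: blinfun_simps volume_vector vector_unit[OF f])
    then show ?thesis unfolding eq by (simp add: blinfun_simps)
  qed
  have "0 *\<^sub>R x + (b + b) *\<^sub>R \<omega> x = 0" for x
  proof -
    have "0 *\<^sub>R x + (b + b) *\<^sub>R \<omega> x = (a *\<^sub>R x + b *\<^sub>R \<omega> x + k *\<^sub>R c f x) -
        (a *\<^sub>R x - b *\<^sub>R \<omega> x + k *\<^sub>R c f x)"
      unfolding scaleR_add_left by simp
    then show ?thesis unfolding minus eq by simp
  qed
  then have b: "b = 0" using scalar_volume_independent[of 0 "b + b"] by simp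
  have sum: "a *\<^sub>R x + k *\<^sub>R c f x = 0" for x using eq[of x] b by simp
  have diff: "a *\<^sub>R x - k *\<^sub>R c f x = 0" for x
  proof -
    have "c f (c u x) = - c u (c f x)" using vector_orthogonal[of f u] u(2) by (simp add: inner_commute)
    then have "(u \<bullet> u) *\<^sub>R (a *\<^sub>R x - k *\<^sub>R c f x) = c u (a *\<^sub>R c u x + k *\<^sub>R c f (c u x))"
      by (simp add: blinfun_simps clifford_square[OF clifford] scaleR_diff_right mult.commute)
    then show ?thesis unfolding sum using u(1) by (simp add: blinfun_simps)
  qed
  have "(a + a) *\<^sub>R x + 0 *\<^sub>R \<omega> x = 0" for x
  proof -
    have "(a + a) *\<^sub>R x + 0 *\<^sub>R \<omega> x = (a *\<^sub>R x + k *\<^sub>R c f x) + (a *\<^sub>R x - k *\<^sub>R c f x)"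
      unfolding scaleR_add_left by simp
    then show ?thesis unfolding sum diff by simp
  qed
  then have a: "a = 0" using scalar_volume_independent[of "a + a" 0] by simp
  obtain x :: 's where x: "x \<noteq> 0" using nonzero_Basis[OF SOME_Basis] by blast
  then have "c f x \<noteq> 0" using vector_unit[OF f, of x] by (auto simp: blinfun_simps)
  then show ?thesis using sum[of x] a b by simp
qed

text \<open>
  For \<open>v\<close> orthogonal to \<open>f\<close>, \<open>v D = A v\<close>, and multiplying by \<open>v\<close> on both sides also \<open>v A = D v\<close>. So
  \<open>D + A\<close> and \<open>(D - A) \<omega>\<close> commute with the orthogonal complement of \<open>f\<close>, which determines them up to
  two scalars each. The relation for \<open>v = f\<close> then gives \<open>H\<close>.
\<close>
lemma intertwining_coefficients:
  fixes D A H :: "'s \<Rightarrow>\<^sub>L 's"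
  assumes f: "f \<bullet> f = 1"
    and inter: "\<And>v x. c v (D x) - A (c v x) = (v \<bullet> f) *\<^sub>R H x"
  obtains \<alpha> \<beta> \<gamma> \<delta> where
    "\<And>x. D x = \<alpha> *\<^sub>R x + \<gamma> *\<^sub>R \<omega> x + \<beta> *\<^sub>R c f x + \<delta> *\<^sub>R c f (\<omega> x)"
    "\<And>x. A x = \<alpha> *\<^sub>R x - \<gamma> *\<^sub>R \<omega> x - \<beta> *\<^sub>R c f x + \<delta> *\<^sub>R c f (\<omega> x)"
    "\<And>x. H x = (2 * \<beta>) *\<^sub>R x + (2 * \<delta>) *\<^sub>R \<omega> x"
proof -
  note FF = vector_unit[OF f]
  have Av: "A (c v x) = c v (D x)" if "v \<bullet> f = 0" for v x
    using inter[of v x] that by simp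
  have Dv: "D (c v x) = c v (A x)" if "v \<bullet> f = 0" for v x
  proof (cases "v = 0")
    case True
    then show ?thesis using linear_0[OF clifford_linear[OF clifford]] by (simp add: blinfun_simps)
  next
    case False
    have "(v \<bullet> v) *\<^sub>R D (c v x) = c v (c v (D (c v x)))" by (simp add: clifford_square[OF clifford])
    also have "\<dots> = c v (A (c v (c v x)))" by (simp add: Av[OF that])
    also have "\<dots> = (v \<bullet> v) *\<^sub>R c v (A x)" by (simp add: clifford_square[OF clifford] blinfun_simps)
    finally show ?thesis using False by simp
  qed
  obtain m1 m2 where M: "\<And>x. (D + A) x = m1 *\<^sub>R x + m2 *\<^sub>R c f (\<omega> x)"
    by (rule commutant_of_orthogonal_complement[OF f, of "D + A"])
      (auto simp: commutes_def blinfun_simps Av Dv)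
  have comm_N: "commutes ((D - A) o\<^sub>L \<omega>) (c v)" if "v \<bullet> f = 0" for v
    using that by (simp add: commutes_def blinfun_simps Av Dv volume_vector)
  obtain n1 n2 where N: "\<And>x. ((D - A) o\<^sub>L \<omega>) x = n1 *\<^sub>R x + n2 *\<^sub>R c f (\<omega> x)"
    by (rule commutant_of_orthogonal_complement[OF f comm_N]) auto
  have sum: "D x + A x = m1 *\<^sub>R x + m2 *\<^sub>R c f (\<omega> x)" for x
    using M[of x] by (simp add: blinfun_simps)
  have diff: "D x - A x = n1 *\<^sub>R \<omega> x + n2 *\<^sub>R c f x" for x
    using N[of "\<omega> x"] by (simp add: blinfun_simps volume_square)
  have D: "D x = (m1/2) *\<^sub>R x + (n1/2) *\<^sub>R \<omega> x + (n2/2) *\<^sub>R c f x + (m2/2) *\<^sub>R c f (\<omega> x)" for x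
  proof -
    have "D x = (1/2) *\<^sub>R ((D x + A x) + (D x - A x))" by (simp add: scaleR_2[symmetric])
    then show ?thesis unfolding sum diff by (simp add: scaleR_add_right)
  qed
  have A: "A x = (m1/2) *\<^sub>R x - (n1/2) *\<^sub>R \<omega> x - (n2/2) *\<^sub>R c f x + (m2/2) *\<^sub>R c f (\<omega> x)" for x
  proof -
    have "A x = (1/2) *\<^sub>R ((D x + A x) - (D x - A x))" by (simp add: scaleR_2[symmetric])
    then show ?thesis unfolding sum diff by (simp add: scaleR_add_right scaleR_diff_right)
  qed
  have "H x = n2 *\<^sub>R x + m2 *\<^sub>R \<omega> x" for x
  proof -
    have "H x = c f (D x) - A (c f x)" using inter[of f x] f by simp
    also have "\<dots> = (n2/2 + n2/2) *\<^sub>R x + (m2/2 + m2/2) *\<^sub>R \<omega> x"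
      unfolding scaleR_add_left by (simp add: D A blinfun_simps FF volume_vector)
    finally show ?thesis by simp
  qed
  then show ?thesis using that[OF D A] by simp
qed

text \<open>
  The difference of the two sides of \<open>A H = H D\<close> is
  \<open>- 2 \<gamma> g - 2 \<gamma> h \<omega> + (g\<^sup>2 - h\<^sup>2) f\<close>, whose coefficients must vanish. As
  \<open>H\<close> is nonzero, so is one of \<open>h\<close> and \<open>g\<close>.
\<close>
lemma charge_condition:
  fixes D A H :: "'s \<Rightarrow>\<^sub>L 's"
  assumes f: "f \<bullet> f = 1" and dim: "2 \<le> DIM('e)"
    and D: "\<And>x. D x = \<alpha> *\<^sub>R x + \<gamma> *\<^sub>R \<omega> x + (h/2) *\<^sub>R c f x + (g/2) *\<^sub>R c f (\<omega> x)"
    and A: "\<And>x. A x = \<alpha> *\<^sub>R x - \<gamma> *\<^sub>R \<omega> x - (h/2) *\<^sub>R c f x + (g/2) *\<^sub>R c f (\<omega> x)"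
    and H: "\<And>x. H x = h *\<^sub>R x + g *\<^sub>R \<omega> x"
    and AH: "\<And>x. A (H x) = H (D x)" and "H \<noteq> 0"
  shows "\<gamma> = 0 \<and> h\<^sup>2 = g\<^sup>2"
proof -
  have double: "(r * (s * 2)) *\<^sub>R y = (r * s) *\<^sub>R y + (r * s) *\<^sub>R y" for r s and y :: 's
  proof -
    have "r * (s * 2) = r * s + r * s" by simp
    then show ?thesis by (simp only: scaleR_add_left)
  qed
  have halves: "(r / 2) *\<^sub>R y + (r / 2) *\<^sub>R y = r *\<^sub>R y" for r and y :: 's
    by (simp flip: scaleR_add_left)
  have "(- 2 * \<gamma> * g) *\<^sub>R x + (- 2 * \<gamma> * h) *\<^sub>R \<omega> x + (g\<^sup>2 - h\<^sup>2) *\<^sub>R c f x = A (H x) - H (D x)" for x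
    by (simp add: H D A blinfun_simps vector_unit[OF f] volume_square volume_vector
        algebra_simps power2_eq_square double halves)
  then have "- 2 * \<gamma> * g = 0 \<and> - 2 * \<gamma> * h = 0 \<and> g\<^sup>2 - h\<^sup>2 = 0"
    by (intro scalar_volume_vector_independent[OF f dim]) (simp add: AH)
  moreover have "h \<noteq> 0 \<or> g \<noteq> 0"
    using \<open>H \<noteq> 0\<close> H by (metis add_0 blinfun_eqI scaleR_zero_left blinfun.zero_left)
  ultimately show ?thesis by auto
qed

text \<open>
  The scalars \<open>h\<close> and \<open>g\<close> can be read off from one unit vector, since \<open>H\<close> is the same for all. Then
  \<open>t f\<close> is what remains of \<open>2 D(f)\<close> after the terms with \<open>h\<close> are subtracted; it is a scalar for unit
  vectors, hence for all vectors by homogeneity, and inherits linearity from \<open>D\<close>.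
\<close>
lemma diagonal_blocks:
  fixes D A :: "'e \<Rightarrow> 's \<Rightarrow>\<^sub>L 's" and H :: "'s \<Rightarrow>\<^sub>L 's"
  assumes dim: "2 \<le> DIM('e)" and lin: "linear D" "linear A"
    and inter: "\<And>v f x. c v (D f x) - A f (c v x) = (v \<bullet> f) *\<^sub>R H x"
    and AH: "\<And>f x. A f (H x) = H (D f x)" and H0: "H \<noteq> 0"
  shows "\<exists>\<sigma>\<in>{1, -1 :: real}. \<exists>h t. h \<noteq> (0 :: real) \<and> linear (t :: 'e \<Rightarrow> real) \<and>
    H = h *\<^sub>R (id_blinfun + \<sigma> *\<^sub>R \<omega>) \<and>
    (\<forall>f. A f = (1/2) *\<^sub>R (t f *\<^sub>R id_blinfun - h *\<^sub>R c f + (\<sigma> * h) *\<^sub>R (c f o\<^sub>L \<omega>)) \<and>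
         D f = (1/2) *\<^sub>R (t f *\<^sub>R id_blinfun + h *\<^sub>R c f + (\<sigma> * h) *\<^sub>R (c f o\<^sub>L \<omega>)))"
proof -
  have lin_c: "linear c" by (rule clifford_linear[OF clifford])
  obtain f0 :: 'e where "f0 \<in> Basis" using nonempty_Basis by blast
  then have f0: "f0 \<bullet> f0 = 1" by (simp add: inner_Basis)
  obtain \<alpha>0 \<beta>0 \<gamma>0 \<delta>0 where 0:
    "\<And>x. D f0 x = \<alpha>0 *\<^sub>R x + \<gamma>0 *\<^sub>R \<omega> x + \<beta>0 *\<^sub>R c f0 x + \<delta>0 *\<^sub>R c f0 (\<omega> x)"
    "\<And>x. A f0 x = \<alpha>0 *\<^sub>R x - \<gamma>0 *\<^sub>R \<omega> x - \<beta>0 *\<^sub>R c f0 x + \<delta>0 *\<^sub>R c f0 (\<omega> x)"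
    "\<And>x. H x = (2 * \<beta>0) *\<^sub>R x + (2 * \<delta>0) *\<^sub>R \<omega> x"
    by (rule intertwining_coefficients[OF f0 inter]) (rule that)
  define h where "h = 2 * \<beta>0"
  define g where "g = 2 * \<delta>0"
  have H: "H x = h *\<^sub>R x + g *\<^sub>R \<omega> x" for x by (simp add: 0(3) h_def g_def)
  have \<beta>\<delta>0: "\<beta>0 = h / 2" "\<delta>0 = g / 2" by (simp_all add: h_def g_def)
  have sq: "h\<^sup>2 = g\<^sup>2"
    using charge_condition[OF f0 dim 0(1,2)[unfolded \<beta>\<delta>0] H AH H0] by blast
  have h0: "h \<noteq> 0"
  proof
    assume "h = 0"
    then have "H = 0" using sq H by (intro blinfun_eqI) simp
    then show False using H0 by contradiction
  qed
  obtain \<sigma> where \<sigma>: "\<sigma> \<in> {1, -1}" "g = \<sigma> * h"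
    using sq unfolding power2_eq_iff by (metis insertCI minus_mult_left mult_1 minus_minus)
  define R where "R f = 2 *\<^sub>R D f - h *\<^sub>R c f - (\<sigma> * h) *\<^sub>R (c f o\<^sub>L \<omega>)" for f
  define Q where "Q f = 2 *\<^sub>R A f + h *\<^sub>R c f - (\<sigma> * h) *\<^sub>R (c f o\<^sub>L \<omega>)" for f
  have lin_R: "linear R"
    by (rule linearI; rule blinfun_eqI; simp add: R_def linear_add[OF lin(1)]
        linear_cmul[OF lin(1)] linear_add[OF lin_c] linear_cmul[OF lin_c] blinfun_simps
        algebra_simps)
  have lin_Q: "linear Q"
    by (rule linearI; rule blinfun_eqI; simp add: Q_def linear_add[OF lin(2)]
        linear_cmul[OF lin(2)] linear_add[OF lin_c] linear_cmul[OF lin_c] blinfun_simps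
        algebra_simps)
  have unit: "\<exists>t. R f = t *\<^sub>R id_blinfun \<and> Q f = t *\<^sub>R id_blinfun" if f: "f \<bullet> f = 1" for f
  proof -
    obtain \<alpha> \<beta> \<gamma> \<delta> where 1:
      "\<And>x. D f x = \<alpha> *\<^sub>R x + \<gamma> *\<^sub>R \<omega> x + \<beta> *\<^sub>R c f x + \<delta> *\<^sub>R c f (\<omega> x)"
      "\<And>x. A f x = \<alpha> *\<^sub>R x - \<gamma> *\<^sub>R \<omega> x - \<beta> *\<^sub>R c f x + \<delta> *\<^sub>R c f (\<omega> x)"
      "\<And>x. H x = (2 * \<beta>) *\<^sub>R x + (2 * \<delta>) *\<^sub>R \<omega> x"
      by (rule intertwining_coefficients[OF f inter]) (rule that)
    have "(2 * \<beta> - h) *\<^sub>R x + (2 * \<delta> - g) *\<^sub>R \<omega> x = 0" for x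
    proof -
      have "(2 * \<beta> - h) *\<^sub>R x + (2 * \<delta> - g) *\<^sub>R \<omega> x =
          ((2 * \<beta>) *\<^sub>R x + (2 * \<delta>) *\<^sub>R \<omega> x) - (h *\<^sub>R x + g *\<^sub>R \<omega> x)"
        by (simp add: scaleR_diff_left)
      then show ?thesis using H[of x] 1(3)[of x] by simp
    qed
    then have "2 * \<beta> - h = 0 \<and> 2 * \<delta> - g = 0" by (rule scalar_volume_independent)
    then have \<beta>\<delta>: "\<beta> = h / 2" "\<delta> = g / 2" by auto
    have \<gamma>: "\<gamma> = 0"
      using charge_condition[OF f dim 1(1,2)[unfolded \<beta>\<delta>] H AH H0] by blast
    have "R f = (2 * \<alpha>) *\<^sub>R id_blinfun"
      by (rule blinfun_eqI) (simp add: R_def blinfun_simps 1(1) \<beta>\<delta> \<gamma> \<sigma>(2) scaleR_add_right)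
    moreover have "Q f = (2 * \<alpha>) *\<^sub>R id_blinfun"
      by (rule blinfun_eqI) (simp add: Q_def blinfun_simps 1(2) \<beta>\<delta> \<gamma> \<sigma>(2) scaleR_add_right
          scaleR_diff_right)
    ultimately show ?thesis by blast
  qed
  have "\<exists>t. R f = t *\<^sub>R id_blinfun \<and> Q f = t *\<^sub>R id_blinfun" for f
  proof (cases "f = 0")
    case True
    then show ?thesis by (intro exI[of _ 0]) (simp add: linear_0[OF lin_R] linear_0[OF lin_Q])
  next
    case False
    then have "sgn f \<bullet> sgn f = 1" by (simp add: dot_square_norm norm_sgn)
    then obtain t where t: "R (sgn f) = t *\<^sub>R id_blinfun" "Q (sgn f) = t *\<^sub>R id_blinfun"
      using unit by blast
    have f: "f = norm f *\<^sub>R sgn f" using False by (simp add: sgn_div_norm)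
    have "R f = (norm f * t) *\<^sub>R id_blinfun" "Q f = (norm f * t) *\<^sub>R id_blinfun"
      by (subst f, simp add: linear_cmul[OF lin_R] linear_cmul[OF lin_Q] t)+
    then show ?thesis by blast
  qed
  then obtain t where t: "\<And>f. R f = t f *\<^sub>R id_blinfun" "\<And>f. Q f = t f *\<^sub>R id_blinfun"
    by metis
  have id_inj: "r *\<^sub>R id_blinfun = s *\<^sub>R (id_blinfun :: 's \<Rightarrow>\<^sub>L 's) \<Longrightarrow> r = s" for r s :: real
    using nonzero_Basis[OF SOME_Basis] by (metis blinfun.scaleR_left blinfun_apply_id_blinfun
        id_apply scaleR_cancel_right)
  have "linear t"
  proof (rule linearI)
    show "t (x + y) = t x + t y" for x y
      using linear_add[OF lin_R, of x y] by (intro id_inj) (simp add: t scaleR_add_left)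
    show "t (r *\<^sub>R x) = r *\<^sub>R t x" for r x
      using linear_cmul[OF lin_R, of r x] by (intro id_inj) (simp add: t)
  qed
  moreover have "H = h *\<^sub>R (id_blinfun + \<sigma> *\<^sub>R \<omega>)"
    by (rule blinfun_eqI) (simp add: H \<sigma>(2) blinfun_simps scaleR_add_right mult.commute)
  moreover have "D f = (1/2) *\<^sub>R (t f *\<^sub>R id_blinfun + h *\<^sub>R c f + (\<sigma> * h) *\<^sub>R (c f o\<^sub>L \<omega>))" for f
    using t(1)[of f, symmetric] by (simp add: R_def)
  moreover have "A f = (1/2) *\<^sub>R (t f *\<^sub>R id_blinfun - h *\<^sub>R c f + (\<sigma> * h) *\<^sub>R (c f o\<^sub>L \<omega>))" for f
    using t(2)[of f, symmetric] by (simp add: Q_def)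
  ultimately show ?thesis using \<sigma>(1) h0 by blast
qed

end

section \<open>Blocks of a spin representation\<close>

definition block12 :: "('s::euclidean_space \<times> 's) \<Rightarrow>\<^sub>L ('s \<times> 's) \<Rightarrow> 's \<Rightarrow>\<^sub>L 's"
  where "block12 T = fst_blinfun o\<^sub>L T o\<^sub>L inr_blinfun"

definition block21 :: "('s::euclidean_space \<times> 's) \<Rightarrow>\<^sub>L ('s \<times> 's) \<Rightarrow> 's \<Rightarrow>\<^sub>L 's"
  where "block21 T = snd_blinfun o\<^sub>L T o\<^sub>L inl_blinfun"

lemma block_of_blocks: "block (block11 T) (block12 T) (block21 T) (block22 T) = T"
proof (rule blinfun_eqI)
  fix z :: "'a \<times> 'a"
  obtain x y where z: "z = (x, y)" by fastforce
  have "T (x, y) = T (x, 0) + T (0, y)" by (simp flip: blinfun.add_right)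
  then show "block (block11 T) (block12 T) (block21 T) (block22 T) z = T z"
    by (simp add: z block_apply block11_def block12_def block21_def block22_def prod_eq_iff)
qed

lemma block_eq_iff: "block A B C D = block A' B' C' D' \<longleftrightarrow> A = A' \<and> B = B' \<and> C = C' \<and> D = D'"
proof
  assume eq: "block A B C D = block A' B' C' D'"
  have "(A x + B y, C x + D y) = (A' x + B' y, C' x + D' y)" for x y
    unfolding block_apply[symmetric] eq ..
  from this[of _ 0] this[of 0] show "A = A' \<and> B = B' \<and> C = C' \<and> D = D'"
    by (auto simp: blinfun.zero_right intro: blinfun_eqI)
qed simp

lemma block_compose: "block A B C D o\<^sub>L block A' B' C' D' =
    block ((A o\<^sub>L A') + (B o\<^sub>L C')) ((A o\<^sub>L B') + (B o\<^sub>L D'))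
      ((C o\<^sub>L A') + (D o\<^sub>L C')) ((C o\<^sub>L B') + (D o\<^sub>L D'))"
proof (rule blinfun_eqI)
  fix z :: "'a \<times> 'a"
  show "(block A B C D o\<^sub>L block A' B' C' D') z = block ((A o\<^sub>L A') + (B o\<^sub>L C')) ((A o\<^sub>L B') + (B o\<^sub>L D'))
      ((C o\<^sub>L A') + (D o\<^sub>L C')) ((C o\<^sub>L B') + (D o\<^sub>L D')) z"
    by (cases z) (simp add: block_apply blinfun_simps)
qed

lemma block_diff: "block A B C D - block A' B' C' D' = block (A - A') (B - B') (C - C') (D - D')"
proof (rule blinfun_eqI)
  fix z :: "'a \<times> 'a"
  show "(block A B C D - block A' B' C' D') z = block (A - A') (B - B') (C - C') (D - D') z"
    by (cases z) (simp add: block_apply blinfun_simps)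
qed

lemma block_scaleR: "r *\<^sub>R block A B C D = block (r *\<^sub>R A) (r *\<^sub>R B) (r *\<^sub>R C) (r *\<^sub>R D)"
proof (rule blinfun_eqI)
  fix z :: "'a \<times> 'a"
  show "(r *\<^sub>R block A B C D) z = block (r *\<^sub>R A) (r *\<^sub>R B) (r *\<^sub>R C) (r *\<^sub>R D) z"
    by (cases z) (simp add: block_apply blinfun_simps scaleR_add_right)
qed

lemma form_endomorphism_surj:
  assumes "nondegenerate_form b" "linear B" "\<And>e f. b e f = - ip (B e) f"
  shows "surj (B :: 'e::euclidean_space \<Rightarrow> 'e)"
proof (rule linear_injective_imp_surjective[OF assms(2)])
  have "x = 0" if "B x = 0" for x
    using assms(1) that by (simp add: nondegenerate_form_def assms(3) ip_def)
  then show "inj B" using linear_injective_0[OF assms(2)] by blast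
qed simp

locale nondegenerate_spin_representation =
  fixes b :: "'e::euclidean_space \<Rightarrow> 'e \<Rightarrow> real" and B :: "'e \<Rightarrow> 'e"
    and c :: "'e \<Rightarrow> 's::euclidean_space \<Rightarrow>\<^sub>L 's"
    and \<rho> :: "'e heis \<Rightarrow> ('s \<times> 's) \<Rightarrow>\<^sub>L ('s \<times> 's)"
  assumes dim: "2 \<le> DIM('e)"
    and b: "bilinear b" "nondegenerate_form b"
    and B: "linear B" "\<And>e f. b e f = - ip (B e) f"
    and c: "clifford_module c"
    and spin: "spin_representation b B c \<rho>"
begin

definition "A e = block11 (\<rho> (heis_vec e))"
definition "R e = block12 (\<rho> (heis_vec e))"
definition "D e = block22 (\<rho> (heis_vec e))"

lemma rho_linear: "linear \<rho>"
  and rho_bracket: "\<rho> (heis_bracket b X Y) = (\<rho> X o\<^sub>L \<rho> Y) - (\<rho> Y o\<^sub>L \<rho> X)"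
  and rho_dual: "\<rho> (heis_dual (flat e)) = block 0 (sqrt 2 *\<^sub>R c (B e)) 0 0"
  using spin unfolding spin_representation_def heis_representation_def by blast+

text \<open>
  As \<open>B\<close> is onto, the bracket of \<open>E\<^sup>*\<close> with E can be stated in terms of \<open>v = B e\<close>, with \<open>v\<close> an
  arbitrary vector.
\<close>
lemma bracket_vector:
  "(block 0 (sqrt 2 *\<^sub>R c v) 0 0 o\<^sub>L \<rho> (heis_vec f)) - (\<rho> (heis_vec f) o\<^sub>L block 0 (sqrt 2 *\<^sub>R c v) 0 0)
    = (v \<bullet> f) *\<^sub>R \<rho> heis_p"
proof -
  obtain e where v: "v = B e" using form_endomorphism_surj[OF b(2) B] by (metis surjD)
  have "\<rho> (b e f *\<^sub>R heis_p) = (\<rho> (heis_dual (flat e)) o\<^sub>L \<rho> (heis_vec f))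
      - (\<rho> (heis_vec f) o\<^sub>L \<rho> (heis_dual (flat e)))"
    using rho_bracket[of "heis_dual (flat e)" "heis_vec f"] by (simp add: heis_bracket_dual_vec[OF b(1)])
  then show ?thesis
    by (simp add: rho_dual linear_cmul[OF rho_linear] v B(2) ip_def)
qed

text \<open>
  For \<open>v\<close> orthogonal to \<open>f\<close> the upper left block of the bracket is \<open>sqrt 2 * v\<close> times the lower left
  block of \<open>\<rho>(f)\<close>, and a nonzero \<open>v\<close> acts invertibly.
\<close>
lemma lower_left_zero: "block21 (\<rho> (heis_vec f)) = 0"
proof -
  obtain v where v: "v \<noteq> 0" "v \<bullet> f = 0"
    using orthogonal_to_vector_exists[OF dim, of f] by (auto simp: orthogonal_def inner_commute)
  let ?T = "\<rho> (heis_vec f)"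
  let ?X = "block (block11 ?T) (block12 ?T) (block21 ?T) (block22 ?T)"
  have "(block 0 (sqrt 2 *\<^sub>R c v) 0 0 o\<^sub>L ?X) - (?X o\<^sub>L block 0 (sqrt 2 *\<^sub>R c v) 0 0) = block 0 0 0 0"
    using bracket_vector[of v f] v(2) unfolding block_of_blocks by (simp add: block_def)
  then have eq: "(sqrt 2 *\<^sub>R c v) o\<^sub>L block21 ?T = 0"
    unfolding block_compose block_diff block_eq_iff by simp
  have "c v (block21 ?T x) = 0" for x
    using arg_cong[OF eq, of "\<lambda>T. blinfun_apply T x"] by (simp add: blinfun_simps)
  then have "c v (c v (block21 (\<rho> (heis_vec f)) x)) = 0" for x by (simp add: blinfun.zero_right)
  then show ?thesis using v(1) by (intro blinfun_eqI) (simp add: clifford_square[OF c])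
qed

lemma rho_vec: "\<rho> (heis_vec e) = block (A e) (R e) 0 (D e)"
  using block_of_blocks[of "\<rho> (heis_vec e)"] by (simp add: A_def R_def D_def lower_left_zero)

text \<open>The factor makes the relation \<open>intertwining\<close> below free of constants.\<close>
definition "H = (1 / sqrt 2) *\<^sub>R block12 (\<rho> heis_p)"

lemma bracket_blocks:
  "block 0 (sqrt 2 *\<^sub>R ((c v o\<^sub>L D f) - (A f o\<^sub>L c v))) 0 0 = (v \<bullet> f) *\<^sub>R \<rho> heis_p"
proof -
  have "sqrt 2 *\<^sub>R ((c v o\<^sub>L D f) - (A f o\<^sub>L c v)) = ((sqrt 2 *\<^sub>R c v) o\<^sub>L D f) - (A f o\<^sub>L (sqrt 2 *\<^sub>R c v))"
    by (rule blinfun_eqI) (simp add: blinfun_simps scaleR_diff_right)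
  then show ?thesis
    using bracket_vector[of v f] by (simp add: rho_vec block_compose block_diff)
qed

lemma rho_p: "\<rho> heis_p = sqrt 2 *\<^sub>R block 0 H 0 0"
proof -
  obtain f :: 'e where "f \<in> Basis" using nonempty_Basis by blast
  then have eq: "\<rho> heis_p = block 0 (sqrt 2 *\<^sub>R ((c f o\<^sub>L D f) - (A f o\<^sub>L c f))) 0 0"
    using bracket_blocks[of f f] by (simp add: inner_Basis)
  have "block12 (block X Y Z W) = Y" for X Y Z W :: "'s \<Rightarrow>\<^sub>L 's"
    by (rule blinfun_eqI) (simp add: block12_def block_apply blinfun_simps)
  then show ?thesis unfolding H_def eq by (simp add: block_scaleR)
qed

lemma intertwining: "c v (D f x) - A f (c v x) = (v \<bullet> f) *\<^sub>R H x"
proof -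
  have "sqrt 2 *\<^sub>R ((c v o\<^sub>L D f) - (A f o\<^sub>L c v)) = sqrt 2 *\<^sub>R ((v \<bullet> f) *\<^sub>R H)"
    using bracket_blocks[of v f] by (simp add: rho_p block_scaleR block_eq_iff mult.commute)
  then have eq: "(c v o\<^sub>L D f) - (A f o\<^sub>L c v) = (v \<bullet> f) *\<^sub>R H"
    unfolding scaleR_cancel_left by simp
  show ?thesis using arg_cong[OF eq, of "\<lambda>T. blinfun_apply T x"] by (simp add: blinfun_simps)
qed

lemma charge_commutes: "A f (H x) = H (D f x)"
proof -
  have "(\<rho> heis_p o\<^sub>L \<rho> (heis_vec f)) - (\<rho> (heis_vec f) o\<^sub>L \<rho> heis_p) = 0"
    using rho_bracket[of heis_p "heis_vec f"] by (simp add: heis_bracket_p[OF b(1)] linear_0[OF rho_linear])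
  then have "(\<rho> heis_p o\<^sub>L \<rho> (heis_vec f)) (0, x) = (\<rho> (heis_vec f) o\<^sub>L \<rho> heis_p) (0, x)" by simp
  then show ?thesis by (simp add: rho_p rho_vec block_apply blinfun_simps)
qed

lemma linear_blocks: "linear A" "linear R" "linear D"
proof -
  have lin: "\<rho> (heis_vec (x + y)) = \<rho> (heis_vec x) + \<rho> (heis_vec y)"
    "\<rho> (heis_vec (r *\<^sub>R x)) = r *\<^sub>R \<rho> (heis_vec x)" for x y r
    by (simp_all add: heis_vec_def flip: linear_add[OF rho_linear] linear_cmul[OF rho_linear])
  show "linear A" "linear R" "linear D"
    by (rule linearI; rule blinfun_eqI;
        simp add: A_def R_def D_def block11_def block12_def block22_def lin blinfun_simps)+
qed

lemma upper_right_suitable: "suitable A D R"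
proof -
  have "(\<rho> (heis_vec e) o\<^sub>L \<rho> (heis_vec f)) - (\<rho> (heis_vec f) o\<^sub>L \<rho> (heis_vec e)) = 0" for e f
    using rho_bracket[of "heis_vec e" "heis_vec f"]
    by (simp add: heis_bracket_vec_vec[OF b(1)] linear_0[OF rho_linear])
  then have "\<rho> (heis_vec e) o\<^sub>L \<rho> (heis_vec f) = \<rho> (heis_vec f) o\<^sub>L \<rho> (heis_vec e)" for e f by simp
  then have "(A e o\<^sub>L R f) + (R e o\<^sub>L D f) = (A f o\<^sub>L R e) + (R f o\<^sub>L D e)" for e f
    unfolding rho_vec block_compose block_eq_iff by blast
  then show ?thesis
    using linear_blocks(2) by (simp add: suitable_def algebra_simps)
qed

end

theorem theorem2p16:
  fixes b :: "'e::euclidean_space \<Rightarrow> 'e \<Rightarrow> real"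
    and B :: "'e \<Rightarrow> 'e"
    and c :: "'e \<Rightarrow> 's::euclidean_space \<Rightarrow>\<^sub>L 's"
    and es :: "'e list"
    and \<E> :: "'s \<Rightarrow>\<^sub>L 's"
    and \<rho> :: "'e heis \<Rightarrow> ('s \<times> 's) \<Rightarrow>\<^sub>L ('s \<times> 's)"
  assumes dim: "DIM('e) mod 8 = 0"
    and b: "bilinear b" "symmetric_form b" "nondegenerate_form b"
    and B: "linear B" "\<And>e f. b e f = - ip (B e) f"
    and c: "irreducible_clifford_module c"
    and es: "orthonormal_basis es"
    and \<E>: "\<E> = volume_action c es"
    and \<rho>: "spin_representation b B c \<rho>"
    and charge: "\<rho> heis_p \<noteq> 0"
  shows "\<exists>\<sigma>\<in>{1, -1 :: real}. \<exists>h\<^sub>1 h\<^sub>3 \<rho>\<^sub>1\<^sub>2.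
    h\<^sub>1 \<noteq> (0 :: real) \<and> linear (h\<^sub>3 :: 'e \<Rightarrow> real) \<and> linear (\<rho>\<^sub>1\<^sub>2 :: 'e \<Rightarrow> 's \<Rightarrow>\<^sub>L 's) \<and>
    suitable (\<lambda>e. block11 (\<rho> (heis_vec e))) (\<lambda>e. block22 (\<rho> (heis_vec e))) \<rho>\<^sub>1\<^sub>2 \<and>
    \<rho> heis_p = sqrt 2 *\<^sub>R block 0 (h\<^sub>1 *\<^sub>R (id_blinfun + \<sigma> *\<^sub>R \<E>)) 0 0 \<and>
    (\<forall>e. \<rho> (heis_vec e) = (1/2) *\<^sub>R
      block (h\<^sub>3 e *\<^sub>R id_blinfun - h\<^sub>1 *\<^sub>R c e + (\<sigma> * h\<^sub>1) *\<^sub>R (c e o\<^sub>L \<E>)) (2 *\<^sub>R \<rho>\<^sub>1\<^sub>2 e)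
            0 (h\<^sub>3 e *\<^sub>R id_blinfun + h\<^sub>1 *\<^sub>R c e + (\<sigma> * h\<^sub>1) *\<^sub>R (c e o\<^sub>L \<E>)))"
proof -
  have cm: "clifford_module c" using c by (simp add: irreducible_clifford_module_def)
  have "8 dvd DIM('e)" using dim by (simp add: dvd_eq_mod_eq_0)
  then have four: "4 dvd DIM('e)" and two: "even DIM('e)" and ge: "2 \<le> DIM('e)"
    using dvd_trans[of 4 8 "DIM('e)"] dvd_trans[of 2 8 "DIM('e)"] dvd_imp_le[of 8 "DIM('e)"]
    by simp_all
  interpret volume_module c \<E>
  proof unfold_locales
    show "anticommutes \<E> (c v)" for v unfolding \<E> by (rule volume_action_basis(1)[OF cm es two])
    show "involutive \<E>" unfolding \<E> by (rule volume_action_basis(2)[OF cm es four])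
    show "\<exists>r. t = r *\<^sub>R id_blinfun" if "\<And>v. commutes t (c v)" for t
      using that by (rule clifford_commutant[OF dim c es])
  qed (rule cm)
  interpret nondegenerate_spin_representation b B c \<rho>
    by (rule nondegenerate_spin_representation.intro[OF ge b(1,3) B cm \<rho>])
  have "H \<noteq> 0" using charge rho_p by (auto simp: block_def)
  then obtain \<sigma> h t where \<sigma>: "\<sigma> \<in> {1, -1 :: real}" and h: "h \<noteq> 0" and t: "linear (t :: 'e \<Rightarrow> real)"
    and H: "H = h *\<^sub>R (id_blinfun + \<sigma> *\<^sub>R \<E>)"
    and A: "\<And>f. A f = (1/2) *\<^sub>R (t f *\<^sub>R id_blinfun - h *\<^sub>R c f + (\<sigma> * h) *\<^sub>R (c f o\<^sub>L \<E>))"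
    and D: "\<And>f. D f = (1/2) *\<^sub>R (t f *\<^sub>R id_blinfun + h *\<^sub>R c f + (\<sigma> * h) *\<^sub>R (c f o\<^sub>L \<E>))"
    using diagonal_blocks[OF ge linear_blocks(3,1) intertwining charge_commutes] by blast
  have "suitable (\<lambda>e. block11 (\<rho> (heis_vec e))) (\<lambda>e. block22 (\<rho> (heis_vec e))) R"
    using upper_right_suitable unfolding A_def D_def .
  moreover have "\<rho> heis_p = sqrt 2 *\<^sub>R block 0 (h *\<^sub>R (id_blinfun + \<sigma> *\<^sub>R \<E>)) 0 0"
    using rho_p unfolding H .
  moreover have "\<rho> (heis_vec e) = (1/2) *\<^sub>R
      block (t e *\<^sub>R id_blinfun - h *\<^sub>R c e + (\<sigma> * h) *\<^sub>R (c e o\<^sub>L \<E>)) (2 *\<^sub>R R e)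
            0 (t e *\<^sub>R id_blinfun + h *\<^sub>R c e + (\<sigma> * h) *\<^sub>R (c e o\<^sub>L \<E>))" for e
    using rho_vec[of e] by (simp add: block_scaleR A D)
  ultimately show ?thesis using h t linear_blocks(2) by (intro bexI[OF _ \<sigma>] exI conjI allI)
qed

end
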